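(* Assume (UE) and (ME). Let $u_n,u\in\mathcal U$ satisfy $u_n(x)\to u(x)$ as $n\to\infty$ for each $x\in E$, and assume that for each $x\in E$ $$\sup_{B\in\mathcal E}|P^{u_n(x)}(x,B)-P^{u(x)}(x,B)|\to 0\quad\text{as } n\to\infty .$$ Let $\alpha\in(-\infty,+\infty)\setminus\{0\}$ and let $c:E\times U\to\mathbb R$ be bounded, measurable, and continuous with respect to the second variable. Then for every $x\in E$ $$\sup_{B\in\mathcal E}|\lambda_x^{u_n,\alpha}(B)-\lambda_x^{u,\alpha}(B)|\to 0\quad\text{as } n\to\infty,$$ and furthermore $I_x^\alpha(u_n)\to I_x^\alpha(u)$ as $n\to\infty$.
   Context: $E$ is a Polish space with Borel $\sigma$-field $\mathcal E$; $U$ is a compact set of control parameters; $\mathcal U$ is a family of Borel measurable mappings $u:E\to U$ (Markov controls). For $a\in U$, $P^a(x,\cdot)$ denotes the transition kernel on $E$ under constant control $a$. For each $u\in\mathcal U$, $(X_t^u)_{t=0,1,2,\dots}$ is the discrete-time Markov process on $E$ with transition kernel $P^{u(x)}(x,dy)$ (assumed to be a Markov kernel), $(P^u)^n$ is the $n$-th iterate of this kernel, and $E_x^u$ is expectation when the process starts at $x$. (UE): $\ \sup_{x,x'\in E}\sup_{a,a'\in U}\sup_{B\in\mathcal E}\big(P^a(x,B)-P^{a'}(x',B)\big)=:\Delta<1$. (ME): there is an integer $m\ge1$ such that $\sup_{x,x'\in E}\sup_{u\in\mathcal U}\sup_{B\in\mathcal E}\frac{(P^u)^m(x,B)}{(P^u)^m(x',B)}=:K<\infty$;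 that is, $(P^u)^m(x,B)\le K\,(P^u)^m(x',B)$ for all $x,x'\in E$, $u\in\mathcal U$, $B\in\mathcal E$. The functionals are $$\lambda_x^{u,\alpha}(B)=\liminf_{n\to\infty}\frac1{\alpha n}\ln E_x^u\Big\{e^{\alpha\sum_{i=0}^{n-1}1_B(X_i^u)}\Big\},\qquad I_x^\alpha(u)=\liminf_{n\to\infty}\frac1n\ln E_x^u\Big\{e^{\alpha\sum_{i=0}^{n-1}c(X_i^u,u(X_i^u))}\Big\}.$$ *)

theory Defs
  imports "HOL-Probability.Probability"
begin

text \<open>
  A kernel on the Polish space \<open>'e\<close> is a function \<open>K :: 'e \<Rightarrow> 'e measure\<close>; it is a Markov kernel
  iff \<open>K \<in> borel \<rightarrow>\<^sub>M prob_algebra borel\<close>. A controlled kernel \<open>P a x\<close> gives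
  \<open>P\<^sup>a(x, \<cdot>)\<close>.
\<close>

definition ctrl_kernel :: "('u \<Rightarrow> 'e \<Rightarrow> 'e measure) \<Rightarrow> ('e \<Rightarrow> 'u) \<Rightarrow> 'e \<Rightarrow> 'e measure" where
  "ctrl_kernel P u = (\<lambda>x. P (u x) x)"

primrec kernel_power :: "('e::polish_space \<Rightarrow> 'e measure) \<Rightarrow> nat \<Rightarrow> 'e \<Rightarrow> 'e measure" where
  "kernel_power K 0 x = return borel x"
| "kernel_power K (Suc n) x = kernel_power K n x \<bind> K"

text \<open>
  The law of the Markov process with kernel \<open>K\<close> started at \<open>x\<close>, on the canonical path space
  \<open>nat \<Rightarrow> 'e\<close>. The process itself is the coordinate process \<open>X\<^sub>t \<omega> = \<omega> t\<close>. The law is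
  the Ionescu-Tulcea extension whose coordinate \<open>0\<close> has law \<open>return borel x\<close> and whose coordinate
  \<open>Suc n\<close>, given the past, has law \<open>K (\<omega> n)\<close>.
\<close>

definition path_step ::
    "('e::polish_space \<Rightarrow> 'e measure) \<Rightarrow> 'e \<Rightarrow> nat \<Rightarrow> (nat \<Rightarrow> 'e) \<Rightarrow> 'e measure" where
  "path_step K x n \<omega> = (case n of 0 \<Rightarrow> return borel x | Suc k \<Rightarrow> K (\<omega> k))"

definition path_law :: "('e::polish_space \<Rightarrow> 'e measure) \<Rightarrow> 'e \<Rightarrow> (nat \<Rightarrow> 'e) measure" where
  "path_law K x =
     projective_family.lim UNIV (Ionescu_Tulcea.CI (path_step K x) (\<lambda>_. borel)) (\<lambda>_. borel)"

text \<open>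
  For a Markov kernel the coordinate process under \<open>path_law\<close> starts at \<open>x\<close> and has the Markov
  property with transition kernel \<open>K\<close>; this determines the law.
\<close>

lemma Ionescu_Tulcea_path_step:
  assumes K: "K \<in> borel \<rightarrow>\<^sub>M prob_algebra borel"
  shows "Ionescu_Tulcea (path_step K x) (\<lambda>_. borel)"
proof (rule Ionescu_Tulcea.intro)
  have K': "K \<in> borel \<rightarrow>\<^sub>M subprob_algebra borel"
    using K by (rule measurable_prob_algebraD)
  show "path_step K x i \<in> PiM {0..<i} (\<lambda>_. borel) \<rightarrow>\<^sub>M subprob_algebra borel" for i
  proof (cases i)
    case 0
    then show ?thesis
      by (auto simp: path_step_def[abs_def] space_subprob_algebra
          intro!: measurable_const prob_space_imp_subprob_space prob_space_return)
  next
    case (Suc k)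
    have "(\<lambda>\<omega>. \<omega> k) \<in> PiM {0..<i} (\<lambda>_. borel) \<rightarrow>\<^sub>M (borel :: 'a measure)"
      by (rule measurable_component_singleton) (simp add: Suc)
    from measurable_compose[OF this K'] show ?thesis
      by (simp add: path_step_def[abs_def] Suc)
  qed
  show "prob_space (path_step K x i \<omega>)" for i \<omega>
    using measurable_space[OF K]
    by (auto simp: path_step_def space_prob_algebra prob_space_return split: nat.split)
qed

lemma
  assumes K: "K \<in> borel \<rightarrow>\<^sub>M prob_algebra borel"
  shows sets_path_law: "sets (path_law K x) = sets (PiM UNIV (\<lambda>_. borel))"
    and prob_space_path_law: "prob_space (path_law K x)"
    and path_law_0: "distr (path_law K x) borel (\<lambda>\<omega>. \<omega> 0) = return borel x"
    and path_law_Suc: "\<lbrakk>A \<in> sets (PiM {0..<Suc n} (\<lambda>_. borel)); B \<in> sets borel\<rbrakk> \<Longrightarrow>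
        emeasure (path_law K x)
          {\<omega> \<in> space (path_law K x). restrict \<omega> {0..<Suc n} \<in> A \<and> \<omega> (Suc n) \<in> B} =
        (\<integral>\<^sup>+\<omega>. indicator A (restrict \<omega> {0..<Suc n}) * emeasure (K (\<omega> n)) B \<partial>path_law K x)"
proof -
  interpret Ionescu_Tulcea "path_step K x" "\<lambda>_. borel"
    by (rule Ionescu_Tulcea_path_step[OF K])
  have L: "path_law K x = PF.lim"
    by (simp add: path_law_def)
  show S: "sets (path_law K x) = sets (PiM UNIV (\<lambda>_. borel))"
    by (simp add: L)
  have Sp: "space (path_law K x) = UNIV"
    using sets_eq_imp_space_eq[OF S] by (simp add: space_PiM)
  have R: "(\<lambda>\<omega>. restrict \<omega> J) \<in> path_law K x \<rightarrow>\<^sub>M PiM J (\<lambda>_. borel)" for J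
    unfolding measurable_cong_sets[OF S refl] by (rule measurable_restrict_subset) simp
  have D: "distr (path_law K x) (PiM {0..<n} (\<lambda>_. borel)) (\<lambda>\<omega>. restrict \<omega> {0..<n}) =
      C 0 n (\<lambda>_. undefined)" for n
  proof -
    have "up_to {0..<n} = n"
      using up_to_iff_Ico[of "{0..<n}" n] up_to[of "{0..<n}"] by (cases "n = 0") auto
    then show ?thesis
      using distr_lim[of "{0..<n}"] distr_C[of n n "\<lambda>_. undefined" 0]
      by (simp add: L CI_def space_PiM)
  qed
  show "prob_space (path_law K x)"
    by (rule prob_space_distrD[OF R[of "{0..<0}"]]) (simp only: D, auto intro!: prob_space_return simp: space_PiM)
  show "distr (path_law K x) borel (\<lambda>\<omega>. \<omega> 0) = return borel x"
  proof -
    have m0: "(\<lambda>\<omega>. \<omega> 0) \<in> PiM {0..<Suc 0} (\<lambda>_. borel) \<rightarrow>\<^sub>M (borel :: 'a measure)"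
      by (rule measurable_component_singleton) simp
    have "distr (path_law K x) borel (\<lambda>\<omega>. \<omega> 0) = distr (C 0 (Suc 0) (\<lambda>_. undefined)) borel (\<lambda>\<omega>. \<omega> 0)"
      unfolding D[symmetric] distr_distr[OF m0 R] by (simp add: comp_def)
    also have "C 0 (Suc 0) (\<lambda>_. undefined) = eP 0 (\<lambda>_. undefined)"
      using bind_return[OF measurable_eP[of 0], of "\<lambda>_. undefined"] by (simp add: space_PiM)
    also have "distr (eP 0 (\<lambda>_. undefined)) borel (\<lambda>\<omega>. \<omega> 0) =
        distr (return borel x) borel (\<lambda>y. y)"
    proof -
      have "(\<lambda>y. (\<lambda>_. undefined)(0 := y)) \<in> return borel x \<rightarrow>\<^sub>M PiM {0..<Suc 0} (\<lambda>_. borel)"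
        by (rule measurable_fun_upd[where J="{}"]) (auto simp: space_PiM)
      from distr_distr[OF m0 this] show ?thesis
        by (simp add: eP_def path_step_def comp_def)
    qed
    finally show ?thesis
      by (simp add: distr_id2)
  qed
  show "emeasure (path_law K x)
          {\<omega> \<in> space (path_law K x). restrict \<omega> {0..<Suc n} \<in> A \<and> \<omega> (Suc n) \<in> B} =
        (\<integral>\<^sup>+\<omega>. indicator A (restrict \<omega> {0..<Suc n}) * emeasure (K (\<omega> n)) B \<partial>path_law K x)"
    if A: "A \<in> sets (PiM {0..<Suc n} (\<lambda>_. borel))" and B: "B \<in> sets borel"
  proof -
    let ?m = "Suc n" and ?P = "\<lambda>n. PiM {0..<n} (\<lambda>_. borel :: 'a measure)"
    let ?u = "\<lambda>_::nat. undefined :: 'a"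
    define Z where "Z = {\<omega> \<in> space (?P (Suc ?m)). restrict \<omega> {0..<?m} \<in> A \<and> \<omega> ?m \<in> B}"
    have u: "?u \<in> space (?P 0)"
      by (simp add: space_PiM)
    have r: "(\<lambda>\<omega>. restrict \<omega> {0..<?m}) \<in> ?P (Suc ?m) \<rightarrow>\<^sub>M ?P ?m"
      by (rule measurable_restrict_subset) simp
    have cm: "(\<lambda>\<omega>. \<omega> ?m) \<in> ?P (Suc ?m) \<rightarrow>\<^sub>M (borel :: 'a measure)"
      by (rule measurable_component_singleton) simp
    have cn: "(\<lambda>\<omega>. \<omega> n) \<in> ?P ?m \<rightarrow>\<^sub>M (borel :: 'a measure)"
      by (rule measurable_component_singleton) simp
    have Z: "Z \<in> sets (?P (Suc ?m))"
    proof -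
      have "Z = ((\<lambda>\<omega>. restrict \<omega> {0..<?m}) -` A \<inter> space (?P (Suc ?m))) \<inter>
          ((\<lambda>\<omega>. \<omega> ?m) -` B \<inter> space (?P (Suc ?m)))"
        by (auto simp: Z_def)
      then show ?thesis
        using measurable_sets[OF r A] measurable_sets[OF cm B] by (simp only: sets.Int)
    qed
    have KB: "(\<lambda>y. emeasure (K y) B) \<in> borel_measurable borel"
      using measurable_emeasure_subprob_algebra[OF B] measurable_prob_algebraD[OF K]
      by (rule measurable_compose[rotated])
    have f: "(\<lambda>\<omega>. indicator A \<omega> * emeasure (K (\<omega> n)) B) \<in> borel_measurable (?P ?m)"
      using A measurable_compose[OF cn KB] by simp
    have step: "emeasure (eP ?m \<omega>) Z = indicator A \<omega> * emeasure (K (\<omega> n)) B"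
      if \<omega>: "\<omega> \<in> space (?P ?m)" for \<omega>
    proof -
      have ext: "\<omega> i = undefined" if "i \<notin> {0..<?m}" for i
        using \<omega> that by (auto simp: space_PiM PiE_def extensional_def)
      have "restrict (fun_upd \<omega> ?m y) {0..<?m} = \<omega>" for y
      proof
        fix i show "restrict (fun_upd \<omega> ?m y) {0..<?m} i = \<omega> i"
          using ext[of i] by (cases "i \<in> {0..<?m}") (simp_all add: restrict_def)
      qed
      moreover have "fun_upd \<omega> ?m y \<in> space (?P (Suc ?m))" for y
        unfolding space_PiM PiE_def extensional_def using ext by simp
      ultimately have "fun_upd \<omega> ?m -` Z = (if \<omega> \<in> A then B else {})"
        by (auto simp: Z_def)
      then show ?thesis
        using emeasure_eP[OF \<omega> Z] by (simp add: path_step_def split: split_indicator)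
    qed
    have "emeasure (path_law K x)
          {\<omega> \<in> space (path_law K x). restrict \<omega> {0..<?m} \<in> A \<and> \<omega> ?m \<in> B} =
        emeasure (C 0 (Suc ?m) ?u) Z"
      unfolding D[symmetric] emeasure_distr[OF R Z]
    proof (rule arg_cong[where f="emeasure _"])
      have i: "{0..<Suc ?m} \<inter> {0..<?m} = {0..<?m}"
        by auto
      have "restrict \<omega> {0..<Suc ?m} \<in> space (?P (Suc ?m))" for \<omega> :: "nat \<Rightarrow> 'a"
        by (simp add: space_PiM del: restrict_apply)
      then show "{\<omega> \<in> space (path_law K x). restrict \<omega> {0..<?m} \<in> A \<and> \<omega> ?m \<in> B} =
          (\<lambda>\<omega>. restrict \<omega> {0..<Suc ?m}) -` Z \<inter> space (path_law K x)"
        by (auto simp: Z_def i)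
    qed
    also have "\<dots> = (\<integral>\<^sup>+\<omega>. emeasure (eP ?m \<omega>) Z \<partial>C 0 ?m ?u)"
    proof -
      have "C 0 (Suc ?m) ?u = C 0 ?m ?u \<bind> eP ?m"
        by (simp only: C.simps(2)[of 0 ?m] add_0)
      moreover have "eP ?m \<in> C 0 ?m ?u \<rightarrow>\<^sub>M subprob_algebra (?P (Suc ?m))"
      proof -
        have "sets (C 0 ?m ?u) = sets (?P ?m)"
          using sets_C[OF u, of ?m] by (simp only: add_0)
        from measurable_cong_sets[OF this refl] show ?thesis
          using measurable_eP[of ?m] by blast
      qed
      moreover have "space (C 0 ?m ?u) \<noteq> {}"
        using prob_space.not_empty[OF prob_space_C[OF u]] .
      ultimately show ?thesis
        using emeasure_bind[OF _ _ Z] by (simp only:)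
    qed
    also have "\<dots> = (\<integral>\<^sup>+\<omega>. indicator A \<omega> * emeasure (K (\<omega> n)) B \<partial>C 0 ?m ?u)"
      by (rule nn_integral_cong) (rule step, simp only: space_C[OF u] add_0)
    also have "\<dots> = (\<integral>\<^sup>+\<omega>. indicator A (restrict \<omega> {0..<?m}) * emeasure (K (\<omega> n)) B \<partial>path_law K x)"
      unfolding D[symmetric] using f by (subst nn_integral_distr[OF R]) simp_all
    finally show ?thesis .
  qed
qed

text \<open>
  The supremum in \<open>UE\<close> is over reals in \<open>[-1, 1]\<close>, so it is a genuine supremum (for
  Markov kernels and \<open>U \<noteq> {}\<close>). \<open>ME\<close> is stated without quotients, so that \<open>0 / 0\<close> imposes
  no condition and a positive measure over a null one is excluded.
\<close>

definition UE :: "('u \<Rightarrow> 'e::polish_space \<Rightarrow> 'e measure) \<Rightarrow> 'u set \<Rightarrow> bool" where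
  "UE P U \<longleftrightarrow>
     (SUP x. SUP x'. SUP a\<in>U. SUP a'\<in>U. SUP B\<in>sets borel.
        measure (P a x) B - measure (P a' x') B) < 1"

definition ME :: "('u \<Rightarrow> 'e::polish_space \<Rightarrow> 'e measure) \<Rightarrow> ('e \<Rightarrow> 'u) set \<Rightarrow> bool" where
  "ME P \<U> \<longleftrightarrow>
     (\<exists>m\<ge>1. \<exists>K::real. \<forall>x x'. \<forall>u\<in>\<U>. \<forall>B\<in>sets borel.
        measure (kernel_power (ctrl_kernel P u) m x) B
          \<le> K * measure (kernel_power (ctrl_kernel P u) m x') B)"

text \<open>
  The functionals are extended reals because \<open>liminf\<close> lives in a complete lattice; the value of the
  sequence at \<open>n = 0\<close> is irrelevant.
\<close>

definition occ_functional ::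
    "('u \<Rightarrow> 'e::polish_space \<Rightarrow> 'e measure) \<Rightarrow> real \<Rightarrow> 'e \<Rightarrow> ('e \<Rightarrow> 'u) \<Rightarrow> 'e set \<Rightarrow> ereal" where
  "occ_functional P \<alpha> x u B =
     liminf (\<lambda>n. ereal (1 / (\<alpha> * real n) *
       ln (\<integral>\<omega>. exp (\<alpha> * (\<Sum>i<n. indicator B (\<omega> i))) \<partial>path_law (ctrl_kernel P u) x)))"

definition cost_functional ::
    "('u \<Rightarrow> 'e::polish_space \<Rightarrow> 'e measure) \<Rightarrow> ('e \<times> 'u \<Rightarrow> real) \<Rightarrow> real \<Rightarrow> 'e \<Rightarrow> ('e \<Rightarrow> 'u) \<Rightarrow> ereal" where
  "cost_functional P c \<alpha> x u =
     liminf (\<lambda>n. ereal (1 / real n *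
       ln (\<integral>\<omega>. exp (\<alpha> * (\<Sum>i<n. c (\<omega> i, u (\<omega> i)))) \<partial>path_law (ctrl_kernel P u) x)))"

end

theory Submission
  imports Defs
begin

text \<open>
  Tilt the kernel by a bounded potential: \<open>tilt K g f x = e\<^bsup>g x\<^esup> \<integral> f dK x\<close>. By the Markov property the
  exponential moment of \<open>\<Sum>\<^bsub>i<n\<^esub> g (X\<^sub>i)\<close> is the iterate \<open>a\<^sub>n = (tilt K g)\<^sup>n 1\<close>. Condition \<open>ME\<close> yields a
  Harnack inequality \<open>a\<^sub>n x \<le> L a\<^sub>n x'\<close> whose constant \<open>L\<close> depends neither on \<open>n\<close>, nor on the control, nor on
  the potential (within a given bound). Hence \<open>ln a\<^sub>n\<close> is additive up to \<open>ln L\<close>, so \<open>ln a\<^sub>n / n\<close> converges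
  with error at most \<open>ln L / n\<close>. This uniform rate reduces the theorem to the convergence of \<open>a\<^sub>N\<close>
  for one fixed \<open>N\<close>, which follows by induction on \<open>N\<close> from dominated convergence and the convergence
  of the kernels in total variation.
\<close>

section \<open>Comparison of integrals under two measures\<close>

text \<open>The hypothesis on subsets of \<open>Y\<close> is an inequality of measures,
  \<open>N\<close> cut down to \<open>Y\<close> against \<open>c\<close> times \<open>M\<close> cut
  down to \<open>Y\<close>, and the nonnegative integral is monotone in the measure. Bounds on
  \<open>f\<close> carry this over to the Bochner integral. The localization to \<open>Y\<close>
  serves Hahn sets, where the comparison of measures holds on one side only.\<close>

lemma integral_indicator_le_of_measure_le:
  fixes f :: "'a \<Rightarrow> real"
  assumes fin: "finite_measure M" "finite_measure N" and sets: "sets N = sets M"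
    and Y: "Y \<in> sets M" and c: "c \<ge> 0"
    and le: "\<And>X. X \<in> sets M \<Longrightarrow> X \<subseteq> Y \<Longrightarrow> measure N X \<le> c * measure M X"
    and f: "f \<in> borel_measurable M" and f_bounds: "\<And>y. 0 \<le> f y" "\<And>y. f y \<le> C"
  shows "(\<integral>y. f y * indicator Y y \<partial>N) \<le> c * (\<integral>y. f y * indicator Y y \<partial>M)"
proof -
  interpret M: finite_measure M by fact
  interpret N: finite_measure N by fact
  note [measurable] = Y f
  have YN [measurable]: "Y \<in> sets N" and fN [measurable]: "f \<in> borel_measurable N"
    using Y f sets by (auto simp: measurable_cong_sets[OF sets refl])
  have "density N (indicator Y) \<le> scale_measure (ennreal c) (density M (indicator Y))"
  proof -
    have "emeasure (density N (indicator Y)) X \<le> ennreal c * emeasure (density M (indicator Y)) X"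
      if X: "X \<in> sets M" for X
    proof -
      have XN: "X \<in> sets N" using X sets by simp
      have "emeasure (density N (indicator Y)) X = emeasure N (Y \<inter> X)"
        using XN YN by (subst emeasure_density) (auto simp flip: indicator_inter_arith)
      also have "\<dots> = ennreal (measure N (Y \<inter> X))"
        by (rule N.emeasure_eq_measure)
      also have "\<dots> \<le> ennreal (c * measure M (Y \<inter> X))"
        using le[of "Y \<inter> X"] X by (intro ennreal_leI) auto
      also have "\<dots> = ennreal c * emeasure M (Y \<inter> X)"
        using c by (simp add: M.emeasure_eq_measure ennreal_mult)
      also have "emeasure M (Y \<inter> X) = emeasure (density M (indicator Y)) X"
        using X Y by (subst emeasure_density) (auto simp flip: indicator_inter_arith)
      finally show ?thesis .
    qed
    then show ?thesis
      using sets by (subst le_measure) auto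
  qed
  then have "(\<integral>\<^sup>+y. ennreal (f y) \<partial>density N (indicator Y))
      \<le> (\<integral>\<^sup>+y. ennreal (f y) \<partial>scale_measure (ennreal c) (density M (indicator Y)))"
    by (intro nn_integral_mono_measure) (simp add: sets)
  then have "(\<integral>\<^sup>+y. indicator Y y * ennreal (f y) \<partial>N)
      \<le> ennreal c * (\<integral>\<^sup>+y. indicator Y y * ennreal (f y) \<partial>M)"
    by (simp add: nn_integral_scale_measure nn_integral_density)
  moreover have "indicator Y y * ennreal (f y) = ennreal (f y * indicator Y y)" for y
    by (simp split: split_indicator)
  ultimately have "(\<integral>\<^sup>+y. ennreal (f y * indicator Y y) \<partial>N)
      \<le> ennreal c * (\<integral>\<^sup>+y. ennreal (f y * indicator Y y) \<partial>M)"
    by (simp only:)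
  moreover have "integrable M (\<lambda>y. f y * indicator Y y)" "integrable N (\<lambda>y. f y * indicator Y y)"
    using f_bounds order_trans[OF f_bounds]
    by (auto intro!: M.integrable_const_bound[of _ C] N.integrable_const_bound[of _ C]
        split: split_indicator)
  ultimately have "ennreal (\<integral>y. f y * indicator Y y \<partial>N)
      \<le> ennreal c * ennreal (\<integral>y. f y * indicator Y y \<partial>M)"
    using f_bounds by (simp only: nn_integral_eq_integral AE_I2 mult_nonneg_nonneg indicator_pos_le)
  also have "\<dots> = ennreal (c * (\<integral>y. f y * indicator Y y \<partial>M))"
    using c f_bounds by (subst ennreal_mult) auto
  finally show ?thesis
    using c f_bounds by (subst (asm) ennreal_le_iff) (auto intro!: mult_nonneg_nonneg integral_nonneg_AE)
qed

lemma integral_le_of_measure_le: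
  fixes f :: "'a \<Rightarrow> real"
  assumes "finite_measure M" "finite_measure N" and sets: "sets N = sets M" and "c \<ge> 0"
    and "\<And>X. X \<in> sets M \<Longrightarrow> measure N X \<le> c * measure M X"
    and "f \<in> borel_measurable M" and "\<And>y. 0 \<le> f y" "\<And>y. f y \<le> C"
  shows "(\<integral>y. f y \<partial>N) \<le> c * (\<integral>y. f y \<partial>M)"
proof -
  have "(\<integral>y. f y * indicator (space M) y \<partial>M) = (\<integral>y. f y \<partial>M)"
    "(\<integral>y. f y * indicator (space M) y \<partial>N) = (\<integral>y. f y \<partial>N)"
    using sets_eq_imp_space_eq[OF sets] by (auto intro!: Bochner_Integration.integral_cong)
  then show ?thesis
    using integral_indicator_le_of_measure_le[of M N "space M" c f C] assms by auto
qed

text \<open>A Hahn set \<open>Y\<close> with \<open>N \<le> M\<close> on \<open>Y\<close> and \<open>M \<le> N\<close> off \<open>Y\<close> turns the bound into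
  \<open>C (M Y - N Y)\<close>.\<close>
lemma integral_diff_le_of_measure_diff_le:
  fixes f :: "'a \<Rightarrow> real"
  assumes fin: "finite_measure M" "finite_measure N" and sets: "sets N = sets M"
    and f: "f \<in> borel_measurable M" and f_bounds: "\<And>y. 0 \<le> f y" "\<And>y. f y \<le> C"
    and diff: "\<And>X. X \<in> sets M \<Longrightarrow> measure M X - measure N X \<le> d"
  shows "(\<integral>y. f y \<partial>M) - (\<integral>y. f y \<partial>N) \<le> C * d"
proof -
  interpret M: finite_measure M by fact
  interpret N: finite_measure N by fact
  note [measurable] = f
  have fN [measurable]: "f \<in> borel_measurable N"
    using f by (simp add: measurable_cong_sets[OF sets refl])
  have C: "0 \<le> C"
    using f_bounds order_trans by blast
  obtain Y where Y [measurable]: "Y \<in> sets M"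
    and NM: "\<And>X. X \<in> sets M \<Longrightarrow> X \<subseteq> Y \<Longrightarrow> emeasure N X \<le> emeasure M X"
    and MN: "\<And>X. X \<in> sets M \<Longrightarrow> X \<inter> Y = {} \<Longrightarrow> emeasure M X \<le> emeasure N X"
    using finite_unsigned_Hahn_decomposition[OF fin sets] by blast
  have YN [measurable]: "Y \<in> sets N"
    using Y sets by simp
  let ?Z = "space M - Y"
  have Z: "?Z \<in> sets M" "?Z \<in> sets N"
    using Y sets by auto
  have bd: "\<bar>f y\<bar> \<le> C" "\<bar>C - f y\<bar> \<le> C" for y
    using f_bounds[of y] C by auto
  have int: "integrable M (\<lambda>y. f y * indicator A y)" if "A \<in> sets M" for A
    using bd C that by (intro M.integrable_const_bound[of _ C]) (auto split: split_indicator)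
  have intN: "integrable N (\<lambda>y. f y * indicator A y)" if "A \<in> sets N" for A
    using bd C that by (intro N.integrable_const_bound[of _ C]) (auto split: split_indicator)
  have split: "f y = f y * indicator Y y + f y * indicator ?Z y" if "y \<in> space M" for y
    using that by (simp split: split_indicator)
  have 1: "(\<integral>y. f y \<partial>M) = (\<integral>y. f y * indicator Y y \<partial>M) + (\<integral>y. f y * indicator ?Z y \<partial>M)"
    by (subst Bochner_Integration.integral_add[symmetric, OF int int])
      (auto intro!: Bochner_Integration.integral_cong split)
  have 2: "(\<integral>y. f y \<partial>N) = (\<integral>y. f y * indicator Y y \<partial>N) + (\<integral>y. f y * indicator ?Z y \<partial>N)"
    using sets_eq_imp_space_eq[OF sets]
    by (subst Bochner_Integration.integral_add[symmetric, OF intN intN])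
      (auto intro!: Bochner_Integration.integral_cong split Z)
  have 3: "(\<integral>y. f y * indicator ?Z y \<partial>M) \<le> 1 * (\<integral>y. f y * indicator ?Z y \<partial>N)"
  proof (rule integral_indicator_le_of_measure_le[OF fin(2,1) sets[symmetric] Z(2) _ _ fN f_bounds])
    show "measure M X \<le> 1 * measure N X" if "X \<in> sets N" "X \<subseteq> ?Z" for X
      using MN[of X] that sets by (auto simp: M.emeasure_eq_measure N.emeasure_eq_measure)
  qed simp
  \<comment> \<open>On \<open>Y\<close> the order \<open>N\<close> below \<open>M\<close> has the
    wrong direction for \<open>f\<close> itself. Applied to \<open>C - f\<close>, which is also
    nonnegative, it bounds the excess of the \<open>M\<close>-integral of \<open>f\<close> over
    \<open>Y\<close> by \<open>C * (measure M Y - measure N Y)\<close>.\<close>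
  have 4: "(\<integral>y. (C - f y) * indicator Y y \<partial>N) \<le> 1 * (\<integral>y. (C - f y) * indicator Y y \<partial>M)"
  proof (rule integral_indicator_le_of_measure_le[OF fin sets Y, where C = C])
    show "measure N X \<le> 1 * measure M X" if "X \<in> sets M" "X \<subseteq> Y" for X
      using NM[of X] that sets by (auto simp: M.emeasure_eq_measure N.emeasure_eq_measure)
  qed (use f_bounds in auto)
  have 5: "(\<integral>y. (C - f y) * indicator Y y \<partial>M) = C * measure M Y - (\<integral>y. f y * indicator Y y \<partial>M)"
    using int[OF Y] by (simp add: left_diff_distrib M.emeasure_eq_measure)
  have 6: "(\<integral>y. (C - f y) * indicator Y y \<partial>N) = C * measure N Y - (\<integral>y. f y * indicator Y y \<partial>N)"
    using intN[OF YN] by (simp add: left_diff_distrib N.emeasure_eq_measure)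
  have "C * (measure M Y - measure N Y) \<le> C * d"
    using diff[OF Y] C by (rule mult_left_mono)
  then show ?thesis
    using 1 2 3 4 5 6 by (simp add: right_diff_distrib)
qed

lemma abs_integral_diff_le_of_measure_diff_le:
  fixes f :: "'a \<Rightarrow> real"
  assumes "finite_measure M" "finite_measure N" and sets: "sets N = sets M"
    and "f \<in> borel_measurable M" and "\<And>y. 0 \<le> f y" "\<And>y. f y \<le> C"
    and diff: "\<And>X. X \<in> sets M \<Longrightarrow> \<bar>measure M X - measure N X\<bar> \<le> d"
  shows "\<bar>(\<integral>y. f y \<partial>M) - (\<integral>y. f y \<partial>N)\<bar> \<le> C * d"
proof -
  have "(\<integral>y. f y \<partial>M) - (\<integral>y. f y \<partial>N) \<le> C * d"
    using assms(1-6) by (rule integral_diff_le_of_measure_diff_le) (use diff in \<open>simp add: abs_le_iff\<close>)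
  moreover have "(\<integral>y. f y \<partial>N) - (\<integral>y. f y \<partial>M) \<le> C * d"
  proof (rule integral_diff_le_of_measure_diff_le)
    show "measure N X - measure M X \<le> d" if "X \<in> sets N" for X
      using diff[of X] that sets by auto
  qed (use assms in \<open>auto simp: measurable_cong_sets[OF sets refl]\<close>)
  ultimately show ?thesis by linarith
qed

section \<open>Almost additive sequences\<close>

text \<open>Splitting \<open>p * q\<close> into \<open>p\<close> blocks of length \<open>q\<close>,
  or the other way round, puts \<open>b (p * q) / (p * q)\<close> within \<open>l / q\<close> of
  \<open>b q / q\<close> and within \<open>l / p\<close> of \<open>b p / p\<close>. So
  \<open>b p / p\<close> and \<open>b q / q\<close> differ by at most \<open>l / p + l / q\<close>,
  which gives the Cauchy property.\<close>

lemma almost_additive_div_convergent: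
  fixes b :: "nat \<Rightarrow> real"
  assumes b: "\<And>p q. \<bar>b (p + q) - b p - b q\<bar> \<le> l"
  obtains L where "(\<lambda>n. b n / n) \<longlonglongrightarrow> L" "\<And>n. n > 0 \<Longrightarrow> \<bar>b n / n - L\<bar> \<le> l / n"
proof -
  have l: "0 \<le> l"
    using b[of 0 0] by linarith
  have mult: "\<bar>b (p * q) - p * b q\<bar> \<le> p * l" if "p > 0" for p q
    using that
  proof (induction p rule: nat_induct_non_zero)
    case 1
    then show ?case using l by simp
  next
    case (Suc p)
    then show ?case
      using b[of q "p * q"] by (simp add: algebra_simps)
  qed
  have div: "\<bar>b (p * q) / (p * q) - b q / q\<bar> \<le> l / q" if "p > 0" "q > 0" for p q
  proof -
    have "b (p * q) / (p * q) - b q / q = (b (p * q) - p * b q) / (p * q)"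
      using that by (simp add: field_simps)
    also have "\<bar>\<dots>\<bar> = \<bar>b (p * q) - p * b q\<bar> / (p * q)"
      by simp
    also have "\<dots> \<le> p * l / (p * q)"
      by (intro divide_right_mono mult that) simp
    finally show ?thesis
      using that by simp
  qed
  have near: "\<bar>b p / p - b q / q\<bar> \<le> l / p + l / q" if "p > 0" "q > 0" for p q
    using div[OF that] div[OF that(2,1)] by (simp add: mult.commute)
  have "Cauchy (\<lambda>n. b n / n)"
  proof (rule metric_CauchyI)
    fix e :: real assume e: "0 < e"
    obtain N where N: "2 * l / e < real N"
      using reals_Archimedean2 by blast
    have small: "l / n < e / 2" if "n \<ge> Suc N" for n
    proof -
      have "2 * l / e < n" using N that by linarith
      then show ?thesis using e that by (simp add: field_simps)
    qed
    have "dist (b p / p) (b q / q) < e" if "p \<ge> Suc N" "q \<ge> Suc N" for p q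
      using near[of p q] small[OF that(1)] small[OF that(2)] that unfolding dist_real_def by linarith
    then show "\<exists>M. \<forall>p\<ge>M. \<forall>q\<ge>M. dist (b p / p) (b q / q) < e"
      by blast
  qed
  then obtain L where L: "(\<lambda>n. b n / n) \<longlonglongrightarrow> L"
    using convergent_eq_Cauchy by blast
  \<comment> \<open>Fix \<open>n\<close> and let the other index of \<open>near\<close> tend to
    infinity: its share \<open>l / p\<close> of the error disappears.\<close>
  have "\<bar>b n / n - L\<bar> \<le> l / n" if n: "n > 0" for n
  proof (rule LIMSEQ_le)
    show "(\<lambda>p. \<bar>b n / n - b p / p\<bar>) \<longlonglongrightarrow> \<bar>b n / n - L\<bar>"
      by (intro tendsto_intros L)
    show "(\<lambda>p. l / n + l / real p) \<longlonglongrightarrow> l / n"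
      using tendsto_add[OF tendsto_const[of "l / n"] lim_const_over_n[of l]] by simp
    show "\<exists>N. \<forall>p\<ge>N. \<bar>b n / n - b p / p\<bar> \<le> l / n + l / real p"
      using near[of n] n by (intro exI[of _ 1]) auto
  qed
  with L show ?thesis by (rule that)
qed

section \<open>Tilted kernels and their iterates on bounded functions\<close>

lemma integrable_of_bounded_nonneg:
  fixes f :: "'e::topological_space \<Rightarrow> real"
  assumes "f \<in> borel_measurable borel" "\<And>y. 0 \<le> f y" "\<And>y. f y \<le> t"
    and "prob_space M" and sets: "sets M = sets borel"
  shows "integrable M f"
proof -
  interpret prob_space M by fact
  show ?thesis
    using assms by (intro integrable_const_bound[of _ t]) (auto simp: measurable_cong_sets[OF sets refl])
qed

lemma integral_bounds_of_bounds:
  fixes f :: "'e::topological_space \<Rightarrow> real"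
  assumes f: "f \<in> borel_measurable borel" "\<And>y. 0 \<le> f y" "\<And>y. f y \<le> t"
    and M: "prob_space M" "sets M = sets borel" and s: "\<And>y. s \<le> f y"
  shows "s \<le> (\<integral>y. f y \<partial>M)" "(\<integral>y. f y \<partial>M) \<le> t"
proof -
  interpret prob_space M by fact
  have "integrable M f"
    by (rule integrable_of_bounded_nonneg) (use f M in auto)
  then show "s \<le> (\<integral>y. f y \<partial>M)" "(\<integral>y. f y \<partial>M) \<le> t"
    using f s by (auto intro!: integral_ge_const integral_le_const)
qed

definition tilt :: "('e::polish_space \<Rightarrow> 'e measure) \<Rightarrow> ('e \<Rightarrow> real) \<Rightarrow> ('e \<Rightarrow> real) \<Rightarrow> 'e \<Rightarrow> real"
  where "tilt K g f x = exp (g x) * (\<integral>y. f y \<partial>K x)"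

definition tilted_mass :: "('e::polish_space \<Rightarrow> 'e measure) \<Rightarrow> ('e \<Rightarrow> real) \<Rightarrow> nat \<Rightarrow> 'e \<Rightarrow> real"
  where "tilted_mass K g n = (tilt K g ^^ n) (\<lambda>_. 1)"

text \<open>\<open>lim\<close> yields a plain real, which keeps the later estimates in real
  arithmetic. It carries information only where the sequence converges;
  \<open>ln_tilted_mass_tendsto\<close> supplies this.\<close>

definition log_growth :: "('e::polish_space \<Rightarrow> 'e measure) \<Rightarrow> ('e \<Rightarrow> real) \<Rightarrow> 'e \<Rightarrow> real"
  where "log_growth K g x = lim (\<lambda>n. ln (tilted_mass K g n x) / n)"

text \<open>The bound \<open>G\<close> is a parameter instead of the supremum of \<open>g\<close>,
  so that constants derived from it can be shared by a whole sequence of potentials.\<close>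

locale bounded_tilt =
  fixes K :: "'e::polish_space \<Rightarrow> 'e measure" and g :: "'e \<Rightarrow> real" and G :: real
  assumes K: "K \<in> borel \<rightarrow>\<^sub>M prob_algebra borel"
    and g [measurable]: "g \<in> borel_measurable borel"
    and g_bound: "\<And>x. \<bar>g x\<bar> \<le> G"
begin

lemma K_subprob [measurable]: "K \<in> borel \<rightarrow>\<^sub>M subprob_algebra borel"
  using K by (rule measurable_prob_algebraD)

lemma prob_space_K: "prob_space (K x)"
  and sets_K [simp, measurable_cong]: "sets (K x) = sets borel"
  using measurable_space[OF K, of x] by (auto simp: space_prob_algebra)

lemma kernel_power_prob:
  shows sets_kernel_power: "sets (kernel_power K n x) = sets borel"
    and prob_space_kernel_power: "prob_space (kernel_power K n x)"
proof -
  have "kernel_power K n x \<in> space (prob_algebra borel)"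
  proof (induction n)
    case 0
    then show ?case by (simp add: space_prob_algebra prob_space_return)
  next
    case (Suc n)
    \<comment> \<open>The measure is presented as a kernel from a one-point space, so that the
      measurability rule for composing Markov kernels also shows that the composition is a
      probability measure on the Borel sets.\<close>
    have "(\<lambda>_::unit. kernel_power K n x \<bind> K) \<in> count_space UNIV \<rightarrow>\<^sub>M prob_algebra borel"
      using Suc K by (intro measurable_bind_prob_space) auto
    from measurable_space[OF this, of "()"] show ?case by simp
  qed
  then show "sets (kernel_power K n x) = sets borel" "prob_space (kernel_power K n x)"
    by (auto simp: space_prob_algebra)
qed

lemma tilt_measurable [measurable]:
  assumes [measurable]: "f \<in> borel_measurable borel"
  shows "tilt K g f \<in> borel_measurable borel"
  unfolding tilt_def[abs_def] by measurable

lemma tilt_bounds: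
  assumes f: "f \<in> borel_measurable borel" and s: "0 \<le> s" "\<And>y. s \<le> f y" and t: "\<And>y. f y \<le> t"
  shows "exp (- G) * s \<le> tilt K g f x" "tilt K g f x \<le> exp G * t"
proof -
  have f0: "0 \<le> f y" for y using s order_trans by blast
  have "- G \<le> g x" "g x \<le> G"
    using g_bound[of x] by auto
  moreover have "s \<le> (\<integral>y. f y \<partial>K x)" "(\<integral>y. f y \<partial>K x) \<le> t"
    using integral_bounds_of_bounds[OF f f0 t prob_space_K sets_K s(2)] by auto
  ultimately show "exp (- G) * s \<le> tilt K g f x" "tilt K g f x \<le> exp G * t"
    using s unfolding tilt_def by (auto intro!: mult_mono)
qed

lemma tilt_pow_measurable [measurable]:
  "f \<in> borel_measurable borel \<Longrightarrow> (tilt K g ^^ n) f \<in> borel_measurable borel"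
  by (induction n) auto

lemma tilt_pow_bounds:
  assumes "f \<in> borel_measurable borel" and "0 \<le> s" "\<And>y. s \<le> f y" and "\<And>y. f y \<le> t"
  shows "exp (- real n * G) * s \<le> (tilt K g ^^ n) f x \<and> (tilt K g ^^ n) f x \<le> exp (real n * G) * t"
proof (induction n arbitrary: x)
  case 0
  then show ?case using assms by simp
next
  case (Suc n)
  have "exp (- G) * (exp (- real n * G) * s) \<le> tilt K g ((tilt K g ^^ n) f) x"
    "tilt K g ((tilt K g ^^ n) f) x \<le> exp G * (exp (real n * G) * t)"
    using assms Suc by (intro tilt_bounds; auto)+
  moreover have "exp (real (Suc n) * G) = exp G * exp (real n * G)"
    "exp (- real (Suc n) * G) = exp (- G) * exp (- real n * G)"
    by (simp_all add: algebra_simps flip: exp_add)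
  ultimately show ?case
    unfolding funpow.simps comp_apply by (simp only: mult.assoc)
qed

lemma tilt_pow_nonneg:
  assumes "f \<in> borel_measurable borel" "\<And>y. 0 \<le> f y" "\<And>y. f y \<le> t"
  shows "0 \<le> (tilt K g ^^ n) f x"
  using tilt_pow_bounds[of f 0 t n x] assms by simp

lemma tilt_mono:
  assumes "f \<in> borel_measurable borel" "f' \<in> borel_measurable borel"
    and "\<And>y. 0 \<le> f y" "\<And>y. f y \<le> f' y" "\<And>y. f' y \<le> t"
  shows "tilt K g f x \<le> tilt K g f' x"
proof -
  have "0 \<le> f' y" "f y \<le> t" for y
    using assms(3-5)[of y] by auto
  then have "(\<integral>y. f y \<partial>K x) \<le> (\<integral>y. f' y \<partial>K x)"
    using assms by (intro integral_mono integrable_of_bounded_nonneg[where t = t] prob_space_K) auto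
  then show ?thesis
    by (simp add: tilt_def)
qed

lemma tilt_pow_mono:
  assumes "f \<in> borel_measurable borel" "f' \<in> borel_measurable borel"
    and "\<And>y. 0 \<le> f y" "\<And>y. f y \<le> f' y" "\<And>y. f' y \<le> t"
  shows "(tilt K g ^^ n) f x \<le> (tilt K g ^^ n) f' x"
proof (induction n arbitrary: x)
  case (Suc n)
  have f: "0 \<le> f' y" "f y \<le> t" for y
    using assms(3-5)[of y] by auto
  have "tilt K g ((tilt K g ^^ n) f) x \<le> tilt K g ((tilt K g ^^ n) f') x"
  proof (rule tilt_mono)
    show "0 \<le> (tilt K g ^^ n) f y" for y
      by (rule tilt_pow_nonneg) (use assms f in auto)
    show "(tilt K g ^^ n) f' y \<le> exp (real n * G) * t" for y
      using tilt_pow_bounds[of f' 0 t n y] assms f by simp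
  qed (use assms Suc in auto)
  then show ?case by simp
qed (use assms in simp)

lemma tilt_pow_scale: "(tilt K g ^^ n) (\<lambda>y. r * f y) x = r * (tilt K g ^^ n) f x"
proof (induction n arbitrary: x)
  case (Suc n)
  then have "(tilt K g ^^ n) (\<lambda>y. r * f y) = (\<lambda>x. r * (tilt K g ^^ n) f x)"
    by blast
  moreover have "tilt K g (\<lambda>y. r * h y) x = r * tilt K g h x" for h
    by (simp add: tilt_def)
  ultimately show ?case
    by simp
qed simp

lemma tilt_pow_const: "(tilt K g ^^ n) (\<lambda>_. r) x = r * tilted_mass K g n x"
  using tilt_pow_scale[of n r "\<lambda>_. 1" x] by (simp add: tilted_mass_def)

lemma tilted_mass_add: "tilted_mass K g (p + q) = (tilt K g ^^ p) (tilted_mass K g q)"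
  by (simp add: tilted_mass_def funpow_add)

lemma tilted_mass_measurable [measurable]: "tilted_mass K g n \<in> borel_measurable borel"
  by (simp add: tilted_mass_def)

lemma tilted_mass_bounds:
  "exp (- real n * G) \<le> tilted_mass K g n x" "tilted_mass K g n x \<le> exp (real n * G)"
  using tilt_pow_bounds[of "\<lambda>_. 1" 1 1 n x] by (auto simp: tilted_mass_def)

lemma tilted_mass_pos: "0 < tilted_mass K g n x"
  using exp_gt_zero tilted_mass_bounds(1) by (rule less_le_trans)

text \<open>Each of the \<open>n\<close> tilting factors lies between \<open>exp (- G)\<close> and
  \<open>exp G\<close>, so dropping them all costs at most \<open>exp (real n * G)\<close> in either
  direction. This links \<open>ME\<close>, a statement on the untilted power, to the tilted
  iterates.\<close>

lemma tilt_pow_kernel_power: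
  assumes "f \<in> borel_measurable borel" "\<And>y. 0 \<le> f y" "\<And>y. f y \<le> t"
  shows "exp (- real n * G) * (\<integral>y. f y \<partial>kernel_power K n x) \<le> (tilt K g ^^ n) f x"
    and "(tilt K g ^^ n) f x \<le> exp (real n * G) * (\<integral>y. f y \<partial>kernel_power K n x)"
proof -
  have "exp (- real n * G) * (\<integral>y. f y \<partial>kernel_power K n x) \<le> (tilt K g ^^ n) f x \<and>
      (tilt K g ^^ n) f x \<le> exp (real n * G) * (\<integral>y. f y \<partial>kernel_power K n x)"
    using assms
  \<comment> \<open>\<open>kernel_power\<close> splits off its last step, so the innermost tilt is
    peeled from the iterate and the induction hypothesis is applied to \<open>tilt K g f\<close>
    with the new bound \<open>exp G * t\<close>. Hence \<open>f\<close> and \<open>t\<close> must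
    vary.\<close>
  proof (induction n arbitrary: f t)
    case 0
    then show ?case by (simp add: integral_return)
  next
    case (Suc n)
    note [measurable] = Suc.prems(1)
    let ?M = "kernel_power K n x"
    interpret M: prob_space ?M by (rule prob_space_kernel_power)
    have setsM: "sets ?M = sets borel" by (rule sets_kernel_power)
    have KM: "K \<in> ?M \<rightarrow>\<^sub>M subprob_algebra borel"
      by (simp add: measurable_cong_sets[OF setsM refl])
    let ?h = "\<lambda>y. \<integral>z. f z \<partial>K y"
    have "integral\<^sup>L (?M \<bind> K) f = (\<integral>y. ?h y \<partial>?M)"
    proof (rule integral_bind[OF _ _ KM, where B = t and B' = 1])
      show "\<bar>f y\<bar> \<le> t" for y
        using Suc.prems(2,3)[of y] by simp
      show "AE y in ?M. emeasure (K y) (space (K y)) \<le> ennreal 1"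
        using prob_space.emeasure_space_1[OF prob_space_K] by simp
    qed (auto intro: M.finite_measure_axioms)
    then have bind: "(\<integral>y. f y \<partial>kernel_power K (Suc n) x) = (\<integral>y. ?h y \<partial>?M)"
      by simp
    have h [measurable]: "?h \<in> borel_measurable borel"
      by measurable
    have h_bounds: "0 \<le> ?h y" "?h y \<le> t" for y
      using integral_bounds_of_bounds[OF Suc.prems prob_space_K sets_K, of 0] Suc.prems(2) by auto
    have tilt_f: "0 \<le> tilt K g f y" "tilt K g f y \<le> exp G * t" for y
      using tilt_bounds[of f 0 t y] Suc.prems by auto
    have sandwich: "exp (- G) * ?h y \<le> tilt K g f y" "tilt K g f y \<le> exp G * ?h y" for y
      using g_bound[of y] h_bounds(1)[of y] by (auto simp: tilt_def intro!: mult_right_mono)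
    note int = integrable_of_bounded_nonneg[OF _ _ _ M.prob_space_axioms setsM]
    have int_h: "integrable ?M ?h" and int_t: "integrable ?M (tilt K g f)"
      using int[of ?h t] int[of "tilt K g f" "exp G * t"] h_bounds tilt_f by auto
    have "(\<integral>y. exp (- G) * ?h y \<partial>?M) \<le> (\<integral>y. tilt K g f y \<partial>?M)"
      "(\<integral>y. tilt K g f y \<partial>?M) \<le> (\<integral>y. exp G * ?h y \<partial>?M)"
      using sandwich int_h int_t by - (rule integral_mono; simp)+
    then have 1: "exp (- G) * (\<integral>y. ?h y \<partial>?M) \<le> (\<integral>y. tilt K g f y \<partial>?M)"
      and 2: "(\<integral>y. tilt K g f y \<partial>?M) \<le> exp G * (\<integral>y. ?h y \<partial>?M)"
      by simp_all
    have IH: "exp (- real n * G) * (\<integral>y. tilt K g f y \<partial>?M) \<le> (tilt K g ^^ n) (tilt K g f) x"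
      "(tilt K g ^^ n) (tilt K g f) x \<le> exp (real n * G) * (\<integral>y. tilt K g f y \<partial>?M)"
      using Suc.IH[of "tilt K g f" "exp G * t"] tilt_f by auto
    have pow: "(tilt K g ^^ Suc n) f = (tilt K g ^^ n) (tilt K g f)"
      by (simp add: funpow_swap1)
    have e: "exp (real (Suc n) * G) = exp (real n * G) * exp G"
      "exp (- real (Suc n) * G) = exp (- real n * G) * exp (- G)"
      by (simp_all add: algebra_simps flip: exp_add)
    show ?case
      unfolding bind pow e mult.assoc
      using order_trans[OF mult_left_mono[OF 1, of "exp (- real n * G)"] IH(1)]
        order_trans[OF IH(2) mult_left_mono[OF 2, of "exp (real n * G)"]]
      by simp
  qed
  then show "exp (- real n * G) * (\<integral>y. f y \<partial>kernel_power K n x) \<le> (tilt K g ^^ n) f x"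
    and "(tilt K g ^^ n) f x \<le> exp (real n * G) * (\<integral>y. f y \<partial>kernel_power K n x)"
    by auto
qed

end

section \<open>Harnack inequality and growth rate\<close>

locale harnack_tilt = bounded_tilt +
  fixes m :: nat and C :: real
  assumes kernel_power_le: "\<And>x x' B. B \<in> sets borel \<Longrightarrow>
    measure (kernel_power K m x) B \<le> C * measure (kernel_power K m x') B"
begin

lemma C_ge_1: "1 \<le> C"
proof -
  interpret M: prob_space "kernel_power K m x" for x
    by (rule prob_space_kernel_power)
  have "space (kernel_power K m x) = UNIV" for x
    using sets_eq_imp_space_eq[OF sets_kernel_power] by simp
  then show ?thesis
    using kernel_power_le[of UNIV undefined undefined] M.prob_space by simp
qed

text \<open>One factor \<open>exp (real m * G)\<close> pays for removing the tilt from
  \<open>m\<close> steps at one starting point, a second one for restoring it at the other, and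
  \<open>C\<close> for the change of starting point in between.\<close>

definition harnack_const :: real where
  "harnack_const = C * exp (2 * (real m * G))"

text \<open>Only the first \<open>m\<close> steps see the starting point. The remaining
  \<open>n - m\<close> steps form a nonnegative test function, to which the kernel comparison
  applies whatever its size; this is why the constant does not grow with \<open>n\<close>.\<close>

lemma tilted_mass_harnack: "tilted_mass K g n x \<le> harnack_const * tilted_mass K g n x'"
proof (cases "n < m")
  \<comment> \<open>With fewer than \<open>m\<close> steps the crude bounds
    \<open>exp (real n * G)\<close> and \<open>exp (- real n * G)\<close> are enough: their ratio is
    at most \<open>exp (2 * (real m * G))\<close>, and \<open>1 \<le> C\<close>.\<close>
  case True
  have G: "0 \<le> G"
    using g_bound[of undefined] by linarith
  have "tilted_mass K g n x \<le> exp (real n * G)"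
    by (rule tilted_mass_bounds)
  also have "\<dots> = exp (2 * (real n * G)) * exp (- real n * G)"
    by (simp flip: exp_add)
  also have "\<dots> \<le> harnack_const * tilted_mass K g n x'"
  proof (rule mult_mono)
    have "exp (2 * (real n * G)) \<le> 1 * exp (2 * (real m * G))"
      using True G by (simp add: mult_right_mono)
    also have "\<dots> \<le> harnack_const"
      unfolding harnack_const_def using C_ge_1 by (rule mult_right_mono) simp
    finally show "exp (2 * (real n * G)) \<le> harnack_const" .
  qed (use C_ge_1 tilted_mass_bounds in \<open>auto simp: harnack_const_def\<close>)
  finally show ?thesis .
next
  case False
  define f where "f = tilted_mass K g (n - m)"
  have n: "tilted_mass K g n = (tilt K g ^^ m) f"
    using False tilted_mass_add[of m "n - m"] by (simp add: f_def)
  let ?t = "exp (real (n - m) * G)"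
  have f [measurable]: "f \<in> borel_measurable borel" and f_bounds: "0 \<le> f y" "f y \<le> ?t" for y
    using tilted_mass_bounds(2)[of "n - m"] tilted_mass_pos[THEN less_imp_le] by (auto simp: f_def)
  let ?I = "\<lambda>x. \<integral>y. f y \<partial>kernel_power K m x"
  have "(tilt K g ^^ m) f x \<le> exp (real m * G) * ?I x"
    using f f_bounds by (rule tilt_pow_kernel_power)
  also have "?I x \<le> C * ?I x'"
  proof (rule integral_le_of_measure_le)
    show "finite_measure (kernel_power K m x)" "finite_measure (kernel_power K m x')"
      by (rule prob_space.axioms prob_space_kernel_power)+
    show "f \<in> borel_measurable (kernel_power K m x')"
      by (simp add: measurable_cong_sets[OF sets_kernel_power refl])
  qed (use f_bounds C_ge_1 kernel_power_le in \<open>auto simp: sets_kernel_power\<close>)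
  also have "exp (real m * G) * (C * ?I x') =
      harnack_const * (exp (- real m * G) * ?I x')"
    by (simp add: harnack_const_def flip: exp_add mult.assoc)
  also have "\<dots> \<le> harnack_const * (tilt K g ^^ m) f x'"
    using C_ge_1 f f_bounds
    by (intro mult_left_mono tilt_pow_kernel_power) (auto simp: harnack_const_def)
  finally show ?thesis
    by (simp add: n)
qed

lemma harnack_const_ge_1: "1 \<le> harnack_const"
  using tilted_mass_harnack[of 0 undefined undefined] by (simp add: tilted_mass_def)

text \<open>By the Harnack inequality the function \<open>tilted_mass K g q\<close> stays within a
  factor \<open>harnack_const\<close> of its value at \<open>x\<close>. Replacing it by that
  constant inside the monotone iterate of order \<open>p\<close> leaves the product of the two
  masses at \<open>x\<close>, up to this factor.\<close>

lemma ln_tilted_mass_almost_additive: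
  "\<bar>ln (tilted_mass K g (p + q) x) - ln (tilted_mass K g p x) - ln (tilted_mass K g q x)\<bar>
    \<le> ln harnack_const"
proof -
  let ?a = "\<lambda>n. tilted_mass K g n x" and ?L = harnack_const
  have L: "0 < ?L"
    using harnack_const_ge_1 by linarith
  have "?a (p + q) \<le> (tilt K g ^^ p) (\<lambda>_. ?L * ?a q) x"
    unfolding tilted_mass_add
    using tilted_mass_harnack tilted_mass_pos[THEN less_imp_le]
    by (intro tilt_pow_mono[where t = "?L * ?a q"]) auto
  then have "ln (?a (p + q)) \<le> ln (?L * ?a q * ?a p)"
    using L tilted_mass_pos by (simp add: tilt_pow_const)
  moreover have "(tilt K g ^^ p) (\<lambda>_. ?a q / ?L) x \<le> ?a (p + q)"
    unfolding tilted_mass_add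
    using tilted_mass_harnack[of q x] tilted_mass_pos[THEN less_imp_le] L tilted_mass_bounds(2)
    by (intro tilt_pow_mono[where t = "exp (real q * G)"]) (auto simp: field_simps)
  then have "ln (?a q / ?L * ?a p) \<le> ln (?a (p + q))"
    using L tilted_mass_pos by (subst ln_le_cancel_iff) (auto simp: tilt_pow_const)
  ultimately show ?thesis
    using L tilted_mass_pos[of p x] tilted_mass_pos[of q x]
    by (simp add: ln_mult_pos ln_div)
qed

lemma ln_tilted_mass_tendsto:
  shows "(\<lambda>n. ln (tilted_mass K g n x) / n) \<longlonglongrightarrow> log_growth K g x"
    and "n > 0 \<Longrightarrow> \<bar>ln (tilted_mass K g n x) / n - log_growth K g x\<bar> \<le> ln harnack_const / n"
proof -
  obtain L where L: "(\<lambda>n. ln (tilted_mass K g n x) / n) \<longlonglongrightarrow> L"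
    "\<And>n. n > 0 \<Longrightarrow> \<bar>ln (tilted_mass K g n x) / n - L\<bar> \<le> ln harnack_const / n"
    using almost_additive_div_convergent[of "\<lambda>n. ln (tilted_mass K g n x)" "ln harnack_const"]
      ln_tilted_mass_almost_additive by metis
  moreover have "log_growth K g x = L"
    unfolding log_growth_def using L(1) by (rule limI)
  ultimately show "(\<lambda>n. ln (tilted_mass K g n x) / n) \<longlonglongrightarrow> log_growth K g x"
    and "n > 0 \<Longrightarrow> \<bar>ln (tilted_mass K g n x) / n - log_growth K g x\<bar> \<le> ln harnack_const / n"
    by auto
qed

end

section \<open>Markov property for functions and exponential moments\<close>

text \<open>First half of a monotone class argument: \<open>\<rho>\<close> is the past,
  \<open>X\<close> the present and \<open>Y\<close> the next state. The event \<open>A\<close> of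
  the past is fixed and the induction runs over the function \<open>f\<close> of the next
  state.\<close>

lemma nn_integral_kernel_eq_indicator:
  assumes K [measurable]: "K \<in> S \<rightarrow>\<^sub>M subprob_algebra T"
    and [measurable]: "\<rho> \<in> M \<rightarrow>\<^sub>M N" "X \<in> M \<rightarrow>\<^sub>M S" "Y \<in> M \<rightarrow>\<^sub>M T" "A \<in> sets N"
    and eq: "\<And>B. B \<in> sets T \<Longrightarrow>
      (\<integral>\<^sup>+\<omega>. indicator A (\<rho> \<omega>) * indicator B (Y \<omega>) \<partial>M) =
      (\<integral>\<^sup>+\<omega>. indicator A (\<rho> \<omega>) * emeasure (K (X \<omega>)) B \<partial>M)"
    and f: "f \<in> borel_measurable T"
  shows "(\<integral>\<^sup>+\<omega>. indicator A (\<rho> \<omega>) * f (Y \<omega>) \<partial>M) =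
    (\<integral>\<^sup>+\<omega>. indicator A (\<rho> \<omega>) * (\<integral>\<^sup>+y. f y \<partial>K (X \<omega>)) \<partial>M)"
proof -
  \<comment> \<open>The sigma-field of \<open>K z\<close> is known to be that of \<open>T\<close>
    only for \<open>z\<close> in the space of \<open>S\<close>, hence the restriction to points of
    \<open>space M\<close>.\<close>
  have kernel_measurable: "F \<in> borel_measurable (K (X \<omega>))"
    if "F \<in> borel_measurable T" "\<omega> \<in> space M" for F :: "'b \<Rightarrow> ennreal" and \<omega>
    using that(1) measurable_cong_sets[OF sets_kernel[OF K measurable_space[OF assms(3) that(2)]] refl]
    by blast
  from f show ?thesis
  proof induction
    case (cong f f')
    have X: "X \<omega> \<in> space S" and Y: "Y \<omega> \<in> space T" if "\<omega> \<in> space M" for \<omega>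
      using that by (auto intro: measurable_space assms)
    have "(\<integral>\<^sup>+y. f y \<partial>K z) = (\<integral>\<^sup>+y. f' y \<partial>K z)" if "z \<in> space S" for z
      using cong(3) sets_eq_imp_space_eq[OF sets_kernel[OF K that]] by (intro nn_integral_cong) auto
    then have "(\<integral>\<^sup>+\<omega>. indicator A (\<rho> \<omega>) * (\<integral>\<^sup>+y. f y \<partial>K (X \<omega>)) \<partial>M) =
        (\<integral>\<^sup>+\<omega>. indicator A (\<rho> \<omega>) * (\<integral>\<^sup>+y. f' y \<partial>K (X \<omega>)) \<partial>M)"
      using X by (intro nn_integral_cong) auto
    moreover have "(\<integral>\<^sup>+\<omega>. indicator A (\<rho> \<omega>) * f (Y \<omega>) \<partial>M) =
        (\<integral>\<^sup>+\<omega>. indicator A (\<rho> \<omega>) * f' (Y \<omega>) \<partial>M)"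
      using cong(3) Y by (intro nn_integral_cong) auto
    ultimately show ?case using cong.IH by (simp only:)
  next
    case (set B)
    have "(\<integral>\<^sup>+y. indicator B y \<partial>K (X \<omega>)) = emeasure (K (X \<omega>)) B" if "\<omega> \<in> space M" for \<omega>
      using sets_kernel[OF K, of "X \<omega>"] that set measurable_space[of X M S \<omega>] assms(3) by simp
    then show ?case
      unfolding eq[OF set] by (intro nn_integral_cong) simp
  next
    case (mult f c)
    note [measurable] = mult(2)
    have "(\<integral>\<^sup>+y. c * f y \<partial>K (X \<omega>)) = c * (\<integral>\<^sup>+y. f y \<partial>K (X \<omega>))" if "\<omega> \<in> space M" for \<omega>
      by (intro nn_integral_cmult kernel_measurable mult that)
    then have "(\<integral>\<^sup>+\<omega>. indicator A (\<rho> \<omega>) * (\<integral>\<^sup>+y. c * f y \<partial>K (X \<omega>)) \<partial>M) =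
        (\<integral>\<^sup>+\<omega>. c * (indicator A (\<rho> \<omega>) * (\<integral>\<^sup>+y. f y \<partial>K (X \<omega>))) \<partial>M)"
      by (intro nn_integral_cong) (simp add: mult.left_commute[of _ c])
    then show ?case
      using mult.IH by (simp add: nn_integral_cmult mult.left_commute[of _ c])
  next
    case (add f' f)
    note [measurable] = \<open>f \<in> borel_measurable T\<close> \<open>f' \<in> borel_measurable T\<close>
    have "(\<integral>\<^sup>+y. f y + f' y \<partial>K (X \<omega>)) = (\<integral>\<^sup>+y. f y \<partial>K (X \<omega>)) + (\<integral>\<^sup>+y. f' y \<partial>K (X \<omega>))"
      if "\<omega> \<in> space M" for \<omega>
      by (intro nn_integral_add kernel_measurable add that)
    then have "(\<integral>\<^sup>+\<omega>. indicator A (\<rho> \<omega>) * (\<integral>\<^sup>+y. f y + f' y \<partial>K (X \<omega>)) \<partial>M) =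
        (\<integral>\<^sup>+\<omega>. indicator A (\<rho> \<omega>) * (\<integral>\<^sup>+y. f y \<partial>K (X \<omega>)) +
          indicator A (\<rho> \<omega>) * (\<integral>\<^sup>+y. f' y \<partial>K (X \<omega>)) \<partial>M)"
      by (intro nn_integral_cong) (simp add: distrib_left)
    then show ?case
      using add.IH by (simp add: nn_integral_add distrib_left)
  next
    \<comment> \<open>Monotone convergence is used three times: under \<open>M\<close> on each side
      of the identity, and under the kernel for each fixed \<open>\<omega>\<close>.\<close>
    case (seq U)
    note [measurable] = seq(1)
    have inc: "U i y \<le> U j y" if "i \<le> j" for i j y
      using seq(3) that by (auto simp: incseq_def le_fun_def)
    have "(\<integral>\<^sup>+\<omega>. indicator A (\<rho> \<omega>) * (SUP i. U i) (Y \<omega>) \<partial>M) =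
        (SUP i. \<integral>\<^sup>+\<omega>. indicator A (\<rho> \<omega>) * U i (Y \<omega>) \<partial>M)"
      unfolding SUP_apply SUP_mult_left_ennreal
      by (intro nn_integral_monotone_convergence_SUP)
        (auto simp: incseq_def le_fun_def intro!: mult_left_mono inc)
    also have "\<dots> = (SUP i. \<integral>\<^sup>+\<omega>. indicator A (\<rho> \<omega>) * (\<integral>\<^sup>+y. U i y \<partial>K (X \<omega>)) \<partial>M)"
      using seq.IH by simp
    also have "\<dots> = (\<integral>\<^sup>+\<omega>. (SUP i. indicator A (\<rho> \<omega>) * (\<integral>\<^sup>+y. U i y \<partial>K (X \<omega>))) \<partial>M)"
      by (intro nn_integral_monotone_convergence_SUP[symmetric])
        (auto simp: incseq_def le_fun_def intro!: mult_left_mono nn_integral_mono inc)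
    also have "\<dots> = (\<integral>\<^sup>+\<omega>. indicator A (\<rho> \<omega>) * (\<integral>\<^sup>+y. (SUP i. U i) y \<partial>K (X \<omega>)) \<partial>M)"
    proof (rule nn_integral_cong)
      fix \<omega> assume "\<omega> \<in> space M"
      then have "U i \<in> borel_measurable (K (X \<omega>))" for i
        by (intro kernel_measurable seq(1))
      then show "(SUP i. indicator A (\<rho> \<omega>) * (\<integral>\<^sup>+y. U i y \<partial>K (X \<omega>))) =
          indicator A (\<rho> \<omega>) * (\<integral>\<^sup>+y. (SUP i. U i) y \<partial>K (X \<omega>))"
        unfolding SUP_apply SUP_mult_left_ennreal[symmetric]
        by (subst nn_integral_monotone_convergence_SUP[OF seq(3)]) simp_all
    qed
    finally show ?case .
  qed
qed

text \<open>Second half: now \<open>f\<close> is fixed and the induction runs over the function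
  \<open>h\<close> of the past, the indicator case being the first half.\<close>

lemma nn_integral_kernel_eq:
  assumes K [measurable]: "K \<in> S \<rightarrow>\<^sub>M subprob_algebra T"
    and [measurable]: "\<rho> \<in> M \<rightarrow>\<^sub>M N" "X \<in> M \<rightarrow>\<^sub>M S" "Y \<in> M \<rightarrow>\<^sub>M T"
    and eq: "\<And>A B. A \<in> sets N \<Longrightarrow> B \<in> sets T \<Longrightarrow>
      (\<integral>\<^sup>+\<omega>. indicator A (\<rho> \<omega>) * indicator B (Y \<omega>) \<partial>M) =
      (\<integral>\<^sup>+\<omega>. indicator A (\<rho> \<omega>) * emeasure (K (X \<omega>)) B \<partial>M)"
    and f [measurable]: "f \<in> borel_measurable T" and h: "h \<in> borel_measurable N"
  shows "(\<integral>\<^sup>+\<omega>. h (\<rho> \<omega>) * f (Y \<omega>) \<partial>M) = (\<integral>\<^sup>+\<omega>. h (\<rho> \<omega>) * (\<integral>\<^sup>+y. f y \<partial>K (X \<omega>)) \<partial>M)"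
  using h
proof induction
  case (cong h h')
  have "h (\<rho> \<omega>) = h' (\<rho> \<omega>)" if "\<omega> \<in> space M" for \<omega>
    using cong(3) measurable_space[OF assms(2) that] by simp
  then have "(\<integral>\<^sup>+\<omega>. h (\<rho> \<omega>) * F \<omega> \<partial>M) = (\<integral>\<^sup>+\<omega>. h' (\<rho> \<omega>) * F \<omega> \<partial>M)" for F
    by (intro nn_integral_cong) simp
  then show ?case using cong.IH by (simp only:)
next
  case (set A)
  show ?case
    by (rule nn_integral_kernel_eq_indicator[OF K assms(2-4) set eq[OF set] f])
next
  case (mult h c)
  note [measurable] = mult(2)
  show ?case
    using mult.IH by (simp add: nn_integral_cmult mult.assoc)
next
  case (add h' h)
  note [measurable] = \<open>h \<in> borel_measurable N\<close> \<open>h' \<in> borel_measurable N\<close>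
  show ?case
    using add.IH by (simp add: nn_integral_add distrib_right)
next
  case (seq U)
  note [measurable] = seq(1)
  have inc: "U i y \<le> U j y" if "i \<le> j" for i j y
    using seq(3) that by (auto simp: incseq_def le_fun_def)
  have "(\<integral>\<^sup>+\<omega>. (SUP i. U i) (\<rho> \<omega>) * F \<omega> \<partial>M) = (SUP i. \<integral>\<^sup>+\<omega>. U i (\<rho> \<omega>) * F \<omega> \<partial>M)"
    if [measurable]: "F \<in> borel_measurable M" for F
    unfolding SUP_apply SUP_mult_right_ennreal
    by (intro nn_integral_monotone_convergence_SUP)
      (auto simp: incseq_def le_fun_def intro!: mult_right_mono inc)
  then show ?case
    using seq.IH by simp
qed

lemma nn_integral_path_law_Suc:
  assumes K: "K \<in> borel \<rightarrow>\<^sub>M prob_algebra borel"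
    and h: "h \<in> borel_measurable (PiM {0..<Suc n} (\<lambda>_. borel))"
    and f: "f \<in> borel_measurable borel"
  shows "(\<integral>\<^sup>+\<omega>. h (restrict \<omega> {0..<Suc n}) * f (\<omega> (Suc n)) \<partial>path_law K x) =
    (\<integral>\<^sup>+\<omega>. h (restrict \<omega> {0..<Suc n}) * (\<integral>\<^sup>+y. f y \<partial>K (\<omega> n)) \<partial>path_law K x)"
proof (rule nn_integral_kernel_eq[OF measurable_prob_algebraD[OF K] _ _ _ _ f h])
  have path: "g \<in> PiM UNIV (\<lambda>_. borel) \<rightarrow>\<^sub>M N \<Longrightarrow> g \<in> path_law K x \<rightarrow>\<^sub>M N" for g N
    by (simp add: measurable_cong_sets[OF sets_path_law[OF K] refl])
  show R [measurable]: "(\<lambda>\<omega>. restrict \<omega> {0..<Suc n}) \<in> path_law K x \<rightarrow>\<^sub>M PiM {0..<Suc n} (\<lambda>_. borel)"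
    by (rule path, rule measurable_restrict_subset) simp
  show comp [measurable]: "(\<lambda>\<omega>. \<omega> i) \<in> path_law K x \<rightarrow>\<^sub>M borel" for i
    by (rule path) simp
  then show "(\<lambda>\<omega>. \<omega> (Suc n)) \<in> path_law K x \<rightarrow>\<^sub>M borel" .
  fix A and B :: "'a set"
  assume A [measurable]: "A \<in> sets (PiM {0..<Suc n} (\<lambda>_. borel :: 'a measure))" and B [measurable]: "B \<in> sets borel"
  let ?S = "{\<omega> \<in> space (path_law K x). restrict \<omega> {0..<Suc n} \<in> A \<and> \<omega> (Suc n) \<in> B}"
  have "?S = ((\<lambda>\<omega>. restrict \<omega> {0..<Suc n}) -` A \<inter> space (path_law K x)) \<inter>
      ((\<lambda>\<omega>. \<omega> (Suc n)) -` B \<inter> space (path_law K x))"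
    by blast
  then have S: "?S \<in> sets (path_law K x)"
    using measurable_sets[OF R A] measurable_sets[OF comp B] by (simp only: sets.Int)
  have "(\<integral>\<^sup>+\<omega>. indicator A (restrict \<omega> {0..<Suc n}) * indicator B (\<omega> (Suc n)) \<partial>path_law K x) =
      (\<integral>\<^sup>+\<omega>. indicator ?S \<omega> \<partial>path_law K x)"
    by (intro nn_integral_cong) (simp split: split_indicator)
  also have "\<dots> = emeasure (path_law K x) ?S"
    using S by (rule nn_integral_indicator)
  also have "\<dots> = (\<integral>\<^sup>+\<omega>. indicator A (restrict \<omega> {0..<Suc n}) * emeasure (K (\<omega> n)) B \<partial>path_law K x)"
    by (rule path_law_Suc[OF K A B])
  finally show "(\<integral>\<^sup>+\<omega>. indicator A (restrict \<omega> {0..<Suc n}) * indicator B (\<omega> (Suc n)) \<partial>path_law K x) =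
      (\<integral>\<^sup>+\<omega>. indicator A (restrict \<omega> {0..<Suc n}) * emeasure (K (\<omega> n)) B \<partial>path_law K x)" .
qed

context bounded_tilt
begin

text \<open>A Feynman-Kac formula. Conditioning on the coordinates up to \<open>n\<close> replaces
  the terminal value by its kernel integral; together with the weight of coordinate \<open>n\<close>
  this is \<open>tilt K g f\<close>, a new terminal function for one step less. The terminal factor
  is there to make this induction work; \<open>f = 1\<close> gives the exponential moment.\<close>

lemma nn_integral_path_law_tilt_pow:
  assumes "f \<in> borel_measurable borel" "\<And>y. 0 \<le> f y" "\<And>y. f y \<le> t"
  shows "(\<integral>\<^sup>+\<omega>. ennreal (exp (\<Sum>i<n. g (\<omega> i)) * f (\<omega> n)) \<partial>path_law K x) =
    ennreal ((tilt K g ^^ n) f x)"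
  using assms
proof (induction n arbitrary: f t)
  case 0
  have [measurable]: "(\<lambda>\<omega>. \<omega> 0) \<in> path_law K x \<rightarrow>\<^sub>M borel"
    by (simp add: measurable_cong_sets[OF sets_path_law[OF K] refl])
  have "(\<integral>\<^sup>+\<omega>. ennreal (f (\<omega> 0)) \<partial>path_law K x) =
      (\<integral>\<^sup>+y. ennreal (f y) \<partial>distr (path_law K x) borel (\<lambda>\<omega>. \<omega> 0))"
    using 0 by (subst nn_integral_distr) auto
  also have "\<dots> = ennreal (f x)"
    using 0 by (simp add: path_law_0[OF K] nn_integral_return)
  finally show ?case by simp
next
  case (Suc n)
  note [measurable] = Suc.prems(1)
  \<comment> \<open>\<open>h\<close> depends on the coordinates \<open>0\<close> to \<open>n\<close>
    only, so it is a function of the restricted path. Its factor \<open>exp (g (\<omega> n))\<close>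
    is the one absorbed by \<open>tilt\<close> afterwards.\<close>
  define h where "h \<omega> = ennreal (exp (\<Sum>i<Suc n. g (\<omega> i)))" for \<omega>
  have h: "h \<in> borel_measurable (PiM {0..<Suc n} (\<lambda>_. borel))"
  proof -
    have "(\<lambda>\<omega>. g (\<omega> i)) \<in> borel_measurable (PiM {0..<Suc n} (\<lambda>_. borel))" if "i \<in> {..<Suc n}" for i
      using that by (intro measurable_compose[OF _ g] measurable_component_singleton) auto
    then show ?thesis
      unfolding h_def[abs_def] by (intro measurable_compose[OF _ measurable_ennreal]
          measurable_compose[OF _ borel_measurable_exp] borel_measurable_sum) auto
  qed
  have h_restrict: "h (restrict \<omega> {0..<Suc n}) = h \<omega>" for \<omega>
    unfolding h_def by (intro arg_cong[where f = "\<lambda>z. ennreal (exp z)"] sum.cong) auto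
  have "(\<integral>\<^sup>+\<omega>. ennreal (exp (\<Sum>i<Suc n. g (\<omega> i)) * f (\<omega> (Suc n))) \<partial>path_law K x) =
      (\<integral>\<^sup>+\<omega>. h \<omega> * ennreal (f (\<omega> (Suc n))) \<partial>path_law K x)"
    using Suc.prems(2) by (simp add: h_def ennreal_mult del: sum.lessThan_Suc)
  also have "\<dots> = (\<integral>\<^sup>+\<omega>. h \<omega> * (\<integral>\<^sup>+y. ennreal (f y) \<partial>K (\<omega> n)) \<partial>path_law K x)"
    using nn_integral_path_law_Suc[OF K h, of "\<lambda>y. ennreal (f y)" x] by (simp add: h_restrict)
  also have "\<dots> = (\<integral>\<^sup>+\<omega>. ennreal (exp (\<Sum>i<n. g (\<omega> i)) * tilt K g f (\<omega> n)) \<partial>path_law K x)"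
  proof (rule nn_integral_cong)
    fix \<omega>
    have "(\<integral>\<^sup>+y. ennreal (f y) \<partial>K (\<omega> n)) = ennreal (\<integral>y. f y \<partial>K (\<omega> n))"
      using Suc.prems
      by (intro nn_integral_eq_integral integrable_of_bounded_nonneg[where t = t] prob_space_K) auto
    then show "h \<omega> * (\<integral>\<^sup>+y. ennreal (f y) \<partial>K (\<omega> n)) =
        ennreal (exp (\<Sum>i<n. g (\<omega> i)) * tilt K g f (\<omega> n))"
      using Suc.prems(2)
      by (simp add: h_def tilt_def exp_add mult.assoc flip: ennreal_mult)
  qed
  also have "\<dots> = ennreal ((tilt K g ^^ n) (tilt K g f) x)"
    using tilt_bounds[of f 0 t] Suc.prems by (intro Suc.IH[where t = "exp G * t"]) auto
  finally show ?case
    by (simp add: funpow_swap1)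
qed

lemma integral_path_law_exp_sum:
  "(\<integral>\<omega>. exp (\<Sum>i<n. g (\<omega> i)) \<partial>path_law K x) = tilted_mass K g n x"
proof -
  have "(\<lambda>\<omega>. g (\<omega> i)) \<in> borel_measurable (path_law K x)" for i
    by (rule measurable_compose[OF _ g]) (simp add: measurable_cong_sets[OF sets_path_law[OF K] refl])
  then have "(\<integral>\<omega>. exp (\<Sum>i<n. g (\<omega> i)) \<partial>path_law K x) =
      enn2real (\<integral>\<^sup>+\<omega>. ennreal (exp (\<Sum>i<n. g (\<omega> i))) \<partial>path_law K x)"
    by (intro integral_eq_nn_integral measurable_compose[OF _ borel_measurable_exp]
        borel_measurable_sum) (simp_all add: AE_I2)
  also have "\<dots> = tilted_mass K g n x"
    using nn_integral_path_law_tilt_pow[of "\<lambda>_. 1" 1 x n] tilted_mass_pos[of n x]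
    by (simp add: tilted_mass_def)
  finally show ?thesis .
qed

end

text \<open>The sequence converges, so a negative \<open>a\<close>, which could otherwise turn a
  lower limit into an upper one, does no harm. The occupation functional takes
  \<open>a = \<alpha>\<close>, the cost functional \<open>a = 1\<close>.\<close>

lemma (in harnack_tilt) liminf_path_law_exp_sum:
  "liminf (\<lambda>n. ereal (1 / (a * real n) * ln (\<integral>\<omega>. exp (\<Sum>i<n. g (\<omega> i)) \<partial>path_law K x))) =
    ereal (log_growth K g x / a)"
proof (rule lim_imp_Liminf)
  have "(\<lambda>n. ln (tilted_mass K g n x) / n / a) \<longlonglongrightarrow> log_growth K g x / a"
    using tendsto_mult_right[OF ln_tilted_mass_tendsto(1)[of x], of "inverse a"]
    by (simp only: divide_inverse)
  then show "(\<lambda>n. ereal (1 / (a * real n) * ln (\<integral>\<omega>. exp (\<Sum>i<n. g (\<omega> i)) \<partial>path_law K x)))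
      \<longlonglongrightarrow> ereal (log_growth K g x / a)"
    by (simp add: integral_path_law_exp_sum mult.commute[of a])
qed simp

section \<open>Convergence of tilted masses and growth rates\<close>

lemma abs_ln_diff_le:
  fixes x y s :: real
  assumes "0 < s" "s \<le> x" "s \<le> y"
  shows "\<bar>ln x - ln y\<bar> \<le> \<bar>x - y\<bar> / s"
proof -
  have *: "ln a - ln b \<le> \<bar>a - b\<bar> / s" if "s \<le> a" "s \<le> b" for a b :: real
  proof -
    have ab: "0 < a" "0 < b" using that assms by auto
    have "ln a - ln b \<le> a / b - 1"
      using ln_le_minus_one[of "a / b"] ab by (simp add: ln_div)
    also have "\<dots> = (a - b) / b"
      using ab by (simp add: field_simps)
    also have "\<dots> \<le> \<bar>a - b\<bar> / b"
      using ab by (simp add: divide_right_mono)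
    also have "\<dots> \<le> \<bar>a - b\<bar> / s"
      using ab that assms by (intro divide_left_mono) auto
    finally show ?thesis .
  qed
  show ?thesis
    using *[of x y] *[of y x] assms by (simp add: abs_minus_commute abs_le_iff)
qed

text \<open>The potentials \<open>h n\<close> of the limit kernel may vary with \<open>n\<close>: this is how uniformity over
  Borel sets is obtained without having to take suprema of measurable functions over an
  uncountable family.\<close>
lemma tilted_mass_diff_tendsto_0:
  fixes Q :: "nat \<Rightarrow> 'e::polish_space \<Rightarrow> 'e measure"
  assumes Q: "\<And>n. bounded_tilt (Q n) (g n) G" and K: "\<And>n. bounded_tilt K (h n) G"
    and gh: "\<And>x. (\<lambda>n. g n x - h n x) \<longlonglongrightarrow> 0"
    and d: "\<And>x. (\<lambda>n. d n x) \<longlonglongrightarrow> 0"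
    and d_le: "\<And>n x B. B \<in> sets borel \<Longrightarrow> \<bar>measure (Q n x) B - measure (K x) B\<bar> \<le> d n x"
  shows "(\<lambda>n. tilted_mass (Q n) (g n) k x - tilted_mass K (h n) k x) \<longlonglongrightarrow> 0"
proof (induction k arbitrary: x)
  case 0
  show ?case by (simp add: tilted_mass_def)
next
  case (Suc k)
  interpret Q: bounded_tilt "Q n" "g n" G for n by (rule Q)
  interpret K: bounded_tilt K "h n" G for n by (rule K)
  define C where "C = exp (real k * G)"
  define a where "a n = tilted_mass (Q n) (g n) k" for n
  define b where "b n = tilted_mass K (h n) k" for n
  have [measurable]: "a n \<in> borel_measurable borel" "b n \<in> borel_measurable borel" for n
    unfolding a_def b_def by (rule Q.tilted_mass_measurable K.tilted_mass_measurable)+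
  have a: "0 \<le> a n y" "a n y \<le> C" and b: "0 \<le> b n y" "b n y \<le> C" for n y
    using Q.tilted_mass_pos[of n k y] Q.tilted_mass_bounds(2)[of n k y]
      K.tilted_mass_pos[of n k y] K.tilted_mass_bounds(2)[of n k y]
    by (auto simp: a_def b_def C_def)
  interpret Kx: prob_space "K x" by (rule K.prob_space_K)
  have int: "integrable (K x) (a n)" "integrable (K x) (b n)" for n
    using a b by (auto intro!: integrable_of_bounded_nonneg[where t = C] K.prob_space_K)
  \<comment> \<open>The induction hypothesis is only pointwise. The limit kernel \<open>K x\<close>
    is fixed, and both masses lie between \<open>0\<close> and \<open>C\<close> for all
    \<open>n\<close>, so a constant dominates.\<close>
  have "(\<lambda>n. \<integral>y. a n y - b n y \<partial>K x) \<longlonglongrightarrow> (\<integral>y. 0 \<partial>K x)"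
  proof (rule integral_dominated_convergence[where w = "\<lambda>_. C"])
    show "AE y in K x. (\<lambda>n. a n y - b n y) \<longlonglongrightarrow> 0"
      using Suc by (simp add: a_def b_def)
    show "AE y in K x. norm (a n y - b n y) \<le> C" for n
    proof (rule AE_I2)
      show "norm (a n y - b n y) \<le> C" for y
        using a[of n y] b[of n y] by (simp add: abs_le_iff)
    qed
  qed auto
  then have int_diff: "(\<lambda>n. (\<integral>y. a n y \<partial>K x) - (\<integral>y. b n y \<partial>K x)) \<longlonglongrightarrow> 0"
    using int by simp
  have exp_diff: "(\<lambda>n. exp (g n x - h n x) - 1) \<longlonglongrightarrow> 0"
    using tendsto_diff[OF tendsto_exp[OF gh[of x]] tendsto_const[of 1]] by simp
  \<comment> \<open>The three terms bound, in this order, the passage from \<open>Q n x\<close> to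
    \<open>K x\<close>, the error of the masses over the remaining \<open>k\<close> steps, and the
    change of potential at \<open>x\<close>.\<close>
  define e where "e n = exp G * (C * d n x) +
    exp G * \<bar>(\<integral>y. a n y \<partial>K x) - (\<integral>y. b n y \<partial>K x)\<bar> + exp G * C * \<bar>exp (g n x - h n x) - 1\<bar>" for n
  have "e \<longlonglongrightarrow> exp G * (C * 0) + exp G * \<bar>0\<bar> + exp G * C * \<bar>0\<bar>"
    unfolding e_def[abs_def] by (intro tendsto_intros d int_diff exp_diff)
  then have "e \<longlonglongrightarrow> 0" by simp
  moreover have "\<bar>tilted_mass (Q n) (g n) (Suc k) x - tilted_mass K (h n) (Suc k) x\<bar> \<le> e n" for n
  proof -
    let ?p = "\<integral>y. a n y \<partial>Q n x" and ?q = "\<integral>y. a n y \<partial>K x" and ?r = "\<integral>y. b n y \<partial>K x"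
    have "tilted_mass (Q n) (g n) (Suc k) x = exp (g n x) * ?p"
      "tilted_mass K (h n) (Suc k) x = exp (h n x) * ?r"
      by (simp_all add: tilted_mass_def a_def b_def tilt_def[of _ _ "(_ ^^ _) _"])
    moreover have "exp (g n x) = exp (h n x) * exp (g n x - h n x)"
      by (simp flip: exp_add)
    ultimately have split: "tilted_mass (Q n) (g n) (Suc k) x - tilted_mass K (h n) (Suc k) x =
        exp (g n x) * (?p - ?q) + exp (g n x) * (?q - ?r) + exp (h n x) * ?r * (exp (g n x - h n x) - 1)"
      by (simp add: algebra_simps)
    have exp_le: "exp (g n x) \<le> exp G" "exp (h n x) \<le> exp G"
      using Q.g_bound[of n x] K.g_bound[of n x] by auto
    have "\<bar>?p - ?q\<bar> \<le> C * d n x"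
    proof (rule abs_integral_diff_le_of_measure_diff_le)
      show "finite_measure (Q n x)"
        by (rule prob_space.axioms Q.prob_space_K)+
    qed (use a d_le in \<open>auto intro: Kx.finite_measure_axioms\<close>)
    then have 1: "\<bar>exp (g n x) * (?p - ?q)\<bar> \<le> exp G * (C * d n x)"
      unfolding abs_mult using exp_le by (intro mult_mono) auto
    have 2: "\<bar>exp (g n x) * (?q - ?r)\<bar> \<le> exp G * \<bar>?q - ?r\<bar>"
      unfolding abs_mult using exp_le by (intro mult_mono) auto
    have r: "0 \<le> ?r" "?r \<le> C"
      using integral_bounds_of_bounds[of "b n" C "K x" 0] b K.prob_space_K by auto
    then have 3: "\<bar>exp (h n x) * ?r * (exp (g n x - h n x) - 1)\<bar> \<le> exp G * C * \<bar>exp (g n x - h n x) - 1\<bar>"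
      unfolding abs_mult using exp_le by (intro mult_mono) auto
    show ?thesis
      unfolding split e_def using 1 2 3 by linarith
  qed
  ultimately show ?case
    by (rule_tac Lim_null_comparison[where g = e]) auto
qed

text \<open>For a fixed horizon \<open>N\<close> both growth rates are within
  \<open>ln harnack_const / N\<close> of their approximations, uniformly in \<open>n\<close>. It
  remains to let \<open>n\<close> tend to infinity in the masses at this one horizon.\<close>

lemma log_growth_diff_tendsto_0:
  fixes Q :: "nat \<Rightarrow> 'e::polish_space \<Rightarrow> 'e measure"
  assumes Q: "\<And>n. harnack_tilt (Q n) (g n) G m C" and K: "\<And>n. harnack_tilt K (h n) G m C"
    and gh: "\<And>x. (\<lambda>n. g n x - h n x) \<longlonglongrightarrow> 0"
    and d: "\<And>x. (\<lambda>n. d n x) \<longlonglongrightarrow> 0"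
    and d_le: "\<And>n x B. B \<in> sets borel \<Longrightarrow> \<bar>measure (Q n x) B - measure (K x) B\<bar> \<le> d n x"
  shows "(\<lambda>n. log_growth (Q n) (g n) x - log_growth K (h n) x) \<longlonglongrightarrow> 0"
proof -
  interpret Q: harnack_tilt "Q n" "g n" G m C for n by (rule Q)
  interpret K: harnack_tilt K "h n" G m C for n by (rule K)
  let ?a = "\<lambda>n. tilted_mass (Q n) (g n)" and ?b = "\<lambda>n. tilted_mass K (h n)"
  let ?l = "ln (C * exp (2 * (real m * G)))"
  show ?thesis
  proof (rule LIMSEQ_I)
    fix e :: real assume e: "0 < e"
    \<comment> \<open>Each of the two approximations at horizon \<open>N\<close> may cost
      \<open>e / 4\<close>, which leaves \<open>e / 2\<close> for the difference of the masses. The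
      \<open>max 0\<close> forces \<open>N\<close> to be positive.\<close>
    obtain N :: nat where N: "4 * ?l / e < N" "0 < N"
      using reals_Archimedean2[of "max 0 (4 * ?l / e)"] by auto
    then have l: "?l / N < e / 4"
      using e by (simp add: field_simps)
    \<comment> \<open>A common lower bound of the masses for all \<open>n\<close>; above it the
      logarithm is Lipschitz with constant \<open>1 / ?s\<close>.\<close>
    let ?s = "exp (- real N * G)"
    have "(\<lambda>n. \<bar>?a n N x - ?b n N x\<bar> / ?s / N) \<longlonglongrightarrow> \<bar>0\<bar> / ?s / N"
      using N(2) by (intro tendsto_intros tilted_mass_diff_tendsto_0[where G = G, OF _ _ gh d d_le]
          Q.bounded_tilt_axioms K.bounded_tilt_axioms) auto
    then have "eventually (\<lambda>n. \<bar>?a n N x - ?b n N x\<bar> / ?s / N < e / 2) sequentially"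
      using e by (intro order_tendstoD(2)[of _ "0"]) auto
    moreover have "norm (log_growth (Q n) (g n) x - log_growth K (h n) x - 0) < e"
      if "\<bar>?a n N x - ?b n N x\<bar> / ?s / N < e / 2" for n
    proof -
      have "\<bar>ln (?a n N x) / N - ln (?b n N x) / N\<bar> = \<bar>ln (?a n N x) - ln (?b n N x)\<bar> / N"
        by (simp add: diff_divide_distrib[symmetric])
      also have "\<dots> \<le> \<bar>?a n N x - ?b n N x\<bar> / ?s / N"
        using Q.tilted_mass_bounds(1) K.tilted_mass_bounds(1)
        by (intro divide_right_mono abs_ln_diff_le) auto
      finally have "\<bar>ln (?a n N x) / N - ln (?b n N x) / N\<bar> < e / 2"
        using that by linarith
      moreover have "\<bar>ln (?a n N x) / N - log_growth (Q n) (g n) x\<bar> \<le> ?l / N"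
        "\<bar>ln (?b n N x) / N - log_growth K (h n) x\<bar> \<le> ?l / N"
        using Q.ln_tilted_mass_tendsto(2)[OF N(2)] K.ln_tilted_mass_tendsto(2)[OF N(2)]
        by (auto simp: Q.harnack_const_def K.harnack_const_def)
      ultimately show ?thesis
        using l unfolding real_norm_def by linarith
    qed
    ultimately show "\<exists>no. \<forall>n\<ge>no. norm (log_growth (Q n) (g n) x - log_growth K (h n) x - 0) < e"
      unfolding eventually_sequentially by blast
  qed
qed

section \<open>Uniformity over sets and continuity of the functionals\<close>

text \<open>Uniform convergence follows from convergence along every choice of one member per index:
  if it failed at some level \<open>e\<close>, members exceeding \<open>e\<close> could be chosen
  for infinitely many indices.\<close>

lemma SUP_abs_ereal_tendsto_0:
  fixes r :: "nat \<Rightarrow> 'b \<Rightarrow> real"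
  assumes ne: "\<A> \<noteq> {}" and lim: "\<And>B. (\<And>n. B n \<in> \<A>) \<Longrightarrow> (\<lambda>n. r n (B n)) \<longlonglongrightarrow> 0"
  shows "(\<lambda>n. SUP A\<in>\<A>. \<bar>ereal (r n A)\<bar>) \<longlonglongrightarrow> (0 :: ereal)"
proof (rule order_tendstoI)
  fix z :: ereal assume "z < 0"
  moreover have "0 \<le> (SUP A\<in>\<A>. \<bar>ereal (r n A)\<bar>)" for n
    using ne by (auto intro: SUP_upper2)
  ultimately show "\<forall>\<^sub>F n in sequentially. z < (SUP A\<in>\<A>. \<bar>ereal (r n A)\<bar>)"
    by (intro always_eventually allI) (rule less_le_trans)
next
  fix z :: ereal assume "0 < z"
  then obtain e where e: "0 < ereal e" "ereal e < z"
    using ereal_dense2 by blast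
  obtain A0 where A0: "A0 \<in> \<A>" using ne by blast
  \<comment> \<open>\<open>B n\<close> is a member exceeding \<open>e\<close> if there is one, and
    any member otherwise. Once \<open>B n\<close> itself stays below \<open>e\<close>, so does the
    whole family.\<close>
  define B where "B n = (SOME A. A \<in> \<A> \<and> ((\<exists>A'\<in>\<A>. e < \<bar>r n A'\<bar>) \<longrightarrow> e < \<bar>r n A\<bar>))" for n
  have B: "B n \<in> \<A> \<and> ((\<exists>A'\<in>\<A>. e < \<bar>r n A'\<bar>) \<longrightarrow> e < \<bar>r n (B n)\<bar>)" for n
    unfolding B_def by (rule someI_ex) (use A0 in blast)
  then have "(\<lambda>n. \<bar>r n (B n)\<bar>) \<longlonglongrightarrow> \<bar>0\<bar>"
    by (intro tendsto_rabs lim) auto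
  then have "\<forall>\<^sub>F n in sequentially. \<bar>r n (B n)\<bar> < e"
    using e by (intro order_tendstoD(2)[of _ "\<bar>0\<bar>"]) auto
  then show "\<forall>\<^sub>F n in sequentially. (SUP A\<in>\<A>. \<bar>ereal (r n A)\<bar>) < z"
  proof eventually_elim
    case (elim n)
    then have "\<bar>r n A\<bar> \<le> e" if "A \<in> \<A>" for A
      using B[of n] that by force
    then have "(SUP A\<in>\<A>. \<bar>ereal (r n A)\<bar>) \<le> ereal e"
      by (intro SUP_least) auto
    then show ?case using e(2) by (rule le_less_trans)
  qed
qed

theorem theorem3:
  fixes P :: "'u::topological_space \<Rightarrow> 'e::polish_space \<Rightarrow> 'e measure"
    and U :: "'u set"
    and \<U> :: "('e \<Rightarrow> 'u) set"
    and v :: "nat \<Rightarrow> 'e \<Rightarrow> 'u"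
    and u :: "'e \<Rightarrow> 'u"
    and c :: "'e \<times> 'u \<Rightarrow> real"
    and \<alpha> :: real
  assumes "compact U"
    and "\<And>a. a \<in> U \<Longrightarrow> P a \<in> borel \<rightarrow>\<^sub>M prob_algebra borel"
    and "\<And>w. w \<in> \<U> \<Longrightarrow> w \<in> borel \<rightarrow>\<^sub>M restrict_space borel U"
    and "\<And>w. w \<in> \<U> \<Longrightarrow> ctrl_kernel P w \<in> borel \<rightarrow>\<^sub>M prob_algebra borel"
    and "UE P U"
    and "ME P \<U>"
    and "\<And>n. v n \<in> \<U>" and "u \<in> \<U>"
    and "\<And>x. (\<lambda>n. v n x) \<longlonglongrightarrow> u x"
    and "\<And>x. (\<lambda>n. SUP B\<in>sets borel. \<bar>measure (P (v n x) x) B - measure (P (u x) x) B\<bar>) \<longlonglongrightarrow> 0"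
    and "\<alpha> \<noteq> 0"
    and "bounded (c ` (UNIV \<times> U))"
    and "c \<in> borel \<Otimes>\<^sub>M restrict_space borel U \<rightarrow>\<^sub>M borel"
    and "\<And>x. continuous_on U (\<lambda>a. c (x, a))"
  shows "\<forall>x. (\<lambda>n. SUP B\<in>sets borel. \<bar>occ_functional P \<alpha> x (v n) B - occ_functional P \<alpha> x u B\<bar>)
                \<longlonglongrightarrow> (0::ereal)
           \<and> (\<lambda>n. cost_functional P c \<alpha> x (v n)) \<longlonglongrightarrow> cost_functional P c \<alpha> x u"
proof (intro allI conjI)
  fix x
  note controls = assms(3) and kernels = assms(4) and v = assms(7) and u = assms(8)
    and c_meas = assms(13)
  \<comment> \<open>One pair \<open>m\<close>, \<open>C\<close> serves all controls, so
    \<open>v n\<close> and \<open>u\<close> share their Harnack constants.\<close>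
  obtain m and C :: real where C: "\<And>x x' w B. w \<in> \<U> \<Longrightarrow> B \<in> sets borel \<Longrightarrow>
      measure (kernel_power (ctrl_kernel P w) m x) B \<le> C * measure (kernel_power (ctrl_kernel P w) m x') B"
    using assms(6) unfolding ME_def by blast
  have harnack: "harnack_tilt (ctrl_kernel P w) g G m C"
    if "w \<in> \<U>" "g \<in> borel_measurable borel" "\<And>x. \<bar>g x\<bar> \<le> G" for w g G
    by unfold_locales (use kernels C that in auto)
  define d where "d n y = (SUP B\<in>sets borel. \<bar>measure (P (v n y) y) B - measure (P (u y) y) B\<bar>)" for n y
  have d: "(\<lambda>n. d n y) \<longlonglongrightarrow> 0" for y
    unfolding d_def by (rule assms(10))
  \<comment> \<open>A supremum of reals dominates its members only if they are bounded above; for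
    probability measures \<open>1\<close> is such a bound.\<close>
  have d_le: "\<bar>measure (ctrl_kernel P (v n) y) B - measure (ctrl_kernel P u y) B\<bar> \<le> d n y"
    if "B \<in> sets borel" for n y B
    unfolding d_def ctrl_kernel_def
  proof (rule cSUP_upper[OF that], rule bdd_aboveI2)
    have "prob_space (P (w y) y)" if "w \<in> \<U>" for w
      using measurable_space[OF kernels[OF that], of y] by (simp add: space_prob_algebra ctrl_kernel_def)
    then have le_1: "measure (P (w y) y) A \<le> 1" if "w \<in> \<U>" for w A
      using that prob_space.prob_le_1 by blast
    show "\<bar>measure (P (v n y) y) A - measure (P (u y) y) A\<bar> \<le> 1" for A
      using le_1[OF v, of n A] le_1[OF u, of A] measure_nonneg[of "P (v n y) y" A]
        measure_nonneg[of "P (u y) y" A] by linarith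
  qed
  note growth_tendsto = log_growth_diff_tendsto_0[OF harnack[OF v] harnack[OF u] _ d d_le]

  \<comment> \<open>These potentials are bounded by \<open>\<bar>\<alpha>\<bar>\<close> whatever the
    set, so one Harnack constant covers all Borel sets.\<close>
  let ?g = "\<lambda>B y. \<alpha> * indicator B y"
  have occ: "occ_functional P \<alpha> x w B = ereal (log_growth (ctrl_kernel P w) (?g B) x / \<alpha>)"
    if "w \<in> \<U>" "B \<in> sets borel" for w B
  proof -
    interpret harnack_tilt "ctrl_kernel P w" "?g B" "\<bar>\<alpha>\<bar>" m C
      by (rule harnack) (use that in \<open>auto simp: indicator_def abs_mult\<close>)
    show ?thesis
      using liminf_path_law_exp_sum[of \<alpha> x] by (simp add: occ_functional_def sum_distrib_left)
  qed
  let ?r = "\<lambda>n B. log_growth (ctrl_kernel P (v n)) (?g B) x / \<alpha> - log_growth (ctrl_kernel P u) (?g B) x / \<alpha>"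
  have "(\<lambda>n. SUP B\<in>sets borel. \<bar>ereal (?r n B)\<bar>) \<longlonglongrightarrow> 0"
  proof (rule SUP_abs_ereal_tendsto_0)
    \<comment> \<open>The set may move with \<open>n\<close>, but at each \<open>n\<close> the same
      potential is used under \<open>v n\<close> and under \<open>u\<close>, so the difference of
      potentials is identically \<open>0\<close>.\<close>
    fix B :: "nat \<Rightarrow> 'e set" assume B: "\<And>n. B n \<in> sets borel"
    have "(\<lambda>n. log_growth (ctrl_kernel P (v n)) (?g (B n)) x - log_growth (ctrl_kernel P u) (?g (B n)) x)
        \<longlonglongrightarrow> 0"
      by (rule growth_tendsto[where G = "\<bar>\<alpha>\<bar>"]) (use B in \<open>auto simp: indicator_def abs_mult\<close>)
    from tendsto_divide[OF this tendsto_const[of \<alpha>]] show "(\<lambda>n. ?r n (B n)) \<longlonglongrightarrow> 0"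
      using assms(11) by (simp add: diff_divide_distrib)
  qed auto
  then show "(\<lambda>n. SUP B\<in>sets borel. \<bar>occ_functional P \<alpha> x (v n) B - occ_functional P \<alpha> x u B\<bar>)
      \<longlonglongrightarrow> (0::ereal)"
    using v u by (simp add: occ cong: SUP_cong)

  \<comment> \<open>Here the potential depends on the control. It is bounded because controls take
    values in \<open>U\<close>, and continuity of \<open>c\<close> on \<open>U\<close> makes it
    converge pointwise along \<open>v n\<close>.\<close>
  let ?h = "\<lambda>w y. \<alpha> * c (y, w y)"
  have w_U: "w y \<in> U" if "w \<in> \<U>" for w y
    using measurable_space[OF controls[OF that], of y] by (simp add: space_restrict_space)
  obtain b where b: "\<And>y a. a \<in> U \<Longrightarrow> \<bar>c (y, a)\<bar> \<le> b"
    using assms(12) unfolding bounded_iff by auto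
  have h: "?h w \<in> borel_measurable borel" "\<bar>?h w y\<bar> \<le> \<bar>\<alpha>\<bar> * b" if "w \<in> \<U>" for w y
  proof -
    have "(\<lambda>y. (y, w y)) \<in> borel \<rightarrow>\<^sub>M borel \<Otimes>\<^sub>M restrict_space borel U"
      using controls[OF that] by (intro measurable_Pair) auto
    from measurable_compose[OF this c_meas] show "?h w \<in> borel_measurable borel"
      by (intro borel_measurable_times) auto
    show "\<bar>?h w y\<bar> \<le> \<bar>\<alpha>\<bar> * b"
      using b[OF w_U[OF that]] by (simp add: abs_mult mult_left_mono)
  qed
  have cost: "cost_functional P c \<alpha> x w = ereal (log_growth (ctrl_kernel P w) (?h w) x)" if "w \<in> \<U>" for w
  proof -
    interpret harnack_tilt "ctrl_kernel P w" "?h w" "\<bar>\<alpha>\<bar> * b" m C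
      by (rule harnack) (use that h in auto)
    show ?thesis
      using liminf_path_law_exp_sum[of 1 x] by (simp add: cost_functional_def sum_distrib_left)
  qed
  have "(\<lambda>n. log_growth (ctrl_kernel P (v n)) (?h (v n)) x - log_growth (ctrl_kernel P u) (?h u) x) \<longlonglongrightarrow> 0"
  proof (rule growth_tendsto)
    show "(\<lambda>n. ?h (v n) y - ?h u y) \<longlonglongrightarrow> 0" for y
    proof -
      have "(\<lambda>n. c (y, v n y)) \<longlonglongrightarrow> c (y, u y)"
        using assms(14) assms(9) w_U[OF u] w_U[OF v]
        by (intro continuous_on_tendsto_compose[of U "\<lambda>a. c (y, a)"]) auto
      from tendsto_mult_left[OF this, of \<alpha>] show ?thesis
        by (simp add: LIM_zero_iff)
    qed
  qed (use h u v in auto)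
  then show "(\<lambda>n. cost_functional P c \<alpha> x (v n)) \<longlonglongrightarrow> cost_functional P c \<alpha> x u"
    using v u by (simp add: cost LIM_zero_iff)
qed

end
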